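(* Let $2<\beta<5/2$, $V(x)=|x|^3+3x^2\sin^2x+|x|^\beta$ on $\mathbb{R}$, and $d\mu(x)=Z^{-1}e^{-V(x)}dx$ with $Z$ the normalizing constant. Then $\mu$ satisfies $\mathbf{T}_2(C)$ for some $C>0$, but $\mu$ does not satisfy $\mathbf{LS}(C')$ for any $C'>0$.
   Context: $\mathbf{T}_2(C)$: $W_2^2(\nu,\mu)\le C H(\nu|\mu)$ for all probability measures $\nu$ on $\mathbb{R}$, with $W_2^2(\nu,\mu)=\inf_\pi\int|x-y|^2d\pi$ over couplings of $\nu,\mu$ and $H(\nu|\mu)=\int\log\frac{d\nu}{d\mu}d\nu$ if $\nu\ll\mu$, $+\infty$ otherwise. $\mathbf{LS}(C')$: $\mathrm{Ent}_\mu(f^2)\le C'\int|f'|^2d\mu$ for all smooth $f$, where $\mathrm{Ent}_\mu(g)=\int g\log g\,d\mu-\int g\,d\mu\log\int g\,d\mu$. *)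

theory Defs
  imports "HOL-Probability.Probability"
begin

definition V :: "real \<Rightarrow> real \<Rightarrow> real" where
  "V \<beta> x = \<bar>x\<bar>^3 + 3 * x^2 * (sin x)^2 + \<bar>x\<bar> powr \<beta>"

definition Z :: "real \<Rightarrow> real" where
  "Z \<beta> = (LINT x|lborel. exp (- V \<beta> x))"

definition mu :: "real \<Rightarrow> real measure" where
  "mu \<beta> = density lborel (\<lambda>x. ennreal (exp (- V \<beta> x) / Z \<beta>))"

definition coupling :: "real measure \<Rightarrow> real measure \<Rightarrow> (real \<times> real) measure \<Rightarrow> bool" where
  "coupling \<nu> \<mu> \<pi> \<longleftrightarrow> prob_space \<pi> \<and> sets \<pi> = sets (borel :: (real \<times> real) measure)
     \<and> distr \<pi> borel fst = \<nu> \<and> distr \<pi> borel snd = \<mu>"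

definition W2sq :: "real measure \<Rightarrow> real measure \<Rightarrow> ennreal" where
  "W2sq \<nu> \<mu> = (INF \<pi> \<in> {\<pi>. coupling \<nu> \<mu> \<pi>}. \<integral>\<^sup>+ z. ennreal ((fst z - snd z)^2) \<partial>\<pi>)"

text \<open>Relative entropy H(nu|mu), with value +infinity if nu is not absolutely continuous
  w.r.t. mu or the integral of the log-density diverges (its negative part is always finite).\<close>
definition relent :: "real measure \<Rightarrow> real measure \<Rightarrow> ereal" where
  "relent \<nu> \<mu> =
     (if absolutely_continuous \<mu> \<nu> \<and> integrable \<nu> (\<lambda>x. ln (enn2real (RN_deriv \<mu> \<nu> x)))
      then ereal (\<integral>x. ln (enn2real (RN_deriv \<mu> \<nu> x)) \<partial>\<nu>) else \<infinity>)"

definition satisfies_T2 :: "real measure \<Rightarrow> real \<Rightarrow> bool" where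
  "satisfies_T2 \<mu> C \<longleftrightarrow> (\<forall>\<nu>. prob_space \<nu> \<and> sets \<nu> = sets (borel :: real measure) \<longrightarrow>
      enn2ereal (W2sq \<nu> \<mu>) \<le> ereal C * relent \<nu> \<mu>)"

definition smooth :: "(real \<Rightarrow> real) \<Rightarrow> bool" where
  "smooth f \<longleftrightarrow> (\<forall>k x. ((deriv ^^ k) f) differentiable (at x))"

definition Ent :: "real measure \<Rightarrow> (real \<Rightarrow> real) \<Rightarrow> real" where
  "Ent \<mu> g = (\<integral>x. g x * ln (g x) \<partial>\<mu>) - (\<integral>x. g x \<partial>\<mu>) * ln (\<integral>x. g x \<partial>\<mu>)"

text \<open>Log-Sobolev inequality, required for smooth f for which the entropy is a well-defined
  real number (f^2 and f^2 log f^2 integrable); the Dirichlet energy may be +infinity.\<close>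
definition satisfies_LS :: "real measure \<Rightarrow> real \<Rightarrow> bool" where
  "satisfies_LS \<mu> C' \<longleftrightarrow> (\<forall>f. smooth f \<and> integrable \<mu> (\<lambda>x. (f x)^2)
      \<and> integrable \<mu> (\<lambda>x. (f x)^2 * ln ((f x)^2)) \<longrightarrow>
      ereal (Ent \<mu> (\<lambda>x. (f x)^2)) \<le> ereal C' * enn2ereal (\<integral>\<^sup>+ x. ennreal ((deriv f x)^2) \<partial>\<mu>))"

end

theory Submission
  imports Defs
begin

text \<open>
  Proof idea. Let \<open>F\<close> and \<open>G\<close> be the distribution functions of \<open>\<mu>\<close> and of \<open>\<nu> \<lless> \<mu>\<close>, and let \<open>\<nu>\<close> be
  coupled to \<open>\<mu>\<close> by the monotone map \<open>S = F\<^sup>-\<^sup>1 \<circ> G\<close>. Put \<open>w = ln (G / F)\<close> and let \<open>f\<close> be the density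
  of \<open>\<nu>\<close>. Since \<open>d(G w) = (f w + f - e\<^sup>w) d\<mu>\<close>, the entropy is the integral of
  \<open>e\<^sup>w \<psi>(f / e\<^sup>w)\<close> with \<open>\<psi>(r) = r ln r - r + 1\<close>, and comparing it with \<open>d(G c(w))\<close> bounds
  \<open>\<integral> c(w) d\<nu>\<close> by a multiple of the entropy, where \<open>c(w) = sqrt (1 + w\<^sup>2) - 1\<close> is quadratic near 0 and
  linear at infinity. This is Talagrand's transport inequality for the exponential law, written
  in the coordinate \<open>ln F\<close>. By reflection the same holds for \<open>ln ((1 - G) / (1 - F))\<close>.
  As \<open>V'(x) \<ge> 1 + x\<close> for \<open>x \<ge> 1\<close>, the hazard rate of \<open>\<mu>\<close> grows at least linearly, so the logit
  \<open>L = ln (F / (1 - F))\<close> satisfies \<open>L y - L z \<ge> k (d + d\<^sup>2 / 4)\<close> with \<open>d = y - z \<ge> 0\<close>; hence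
  \<open>(y - S y)\<^sup>2\<close> is controlled by the two costs.

  LS fails because \<open>V'\<close> is only of order \<open>a\<^sup>\<beta>\<^sup>-\<^sup>1\<close> near the points \<open>a = n \<pi> - \<pi> / 4\<close>: on the scale
  \<open>h = a\<^sup>1\<^sup>-\<^sup>\<beta>\<close> the density is constant up to a factor. A smooth function that rises from 0 on \<open>(-\<infinity>, a]\<close>
  to order 1 over a distance \<open>h\<close> has energy at most of order \<open>\<mu>(a, \<infinity>) / h\<^sup>2\<close>, but entropy at least of
  order \<open>\<mu>(a, \<infinity>) a\<^sup>3\<close>, and \<open>h\<^sup>2 a\<^sup>3 = a\<^sup>5\<^sup>-\<^sup>2\<^sup>\<beta>\<close> is unbounded.
\<close>

section \<open>A chain rule for absolutely continuous functions\<close>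

lemma set_integral_nonneg:
  fixes f :: "'a \<Rightarrow> real"
  assumes "\<And>x. x \<in> A \<Longrightarrow> 0 \<le> f x"
  shows "0 \<le> (LINT x:A|M. f x)"
  unfolding set_lebesgue_integral_def using assms
  by (intro Bochner_Integration.integral_nonneg) (auto simp: indicator_def)

text \<open>\<open>G1\<close> and \<open>G2\<close> are antiderivatives of merely integrable
  densities, so the fundamental theorem of calculus cannot be applied pointwise. The error on short
  intervals is at most \<open>\<epsilon>\<close> times the increment of \<open>G1 + G2\<close>; such
  bounds add up, and \<open>\<epsilon>\<close> is arbitrary.\<close>

lemma ac_chain_rule:
  fixes G1 G2 g1 g2 :: "real \<Rightarrow> real" and \<Psi> A B :: "real \<times> real \<Rightarrow> real"
  assumes int1: "\<And>r t. r \<le> t \<Longrightarrow> set_integrable lborel {r<..t} g1"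
    and int2: "\<And>r t. r \<le> t \<Longrightarrow> set_integrable lborel {r<..t} g2"
    and G1: "\<And>r t. r \<le> t \<Longrightarrow> G1 t - G1 r = (LINT s:{r<..t}|lborel. g1 s)"
    and G2: "\<And>r t. r \<le> t \<Longrightarrow> G2 t - G2 r = (LINT s:{r<..t}|lborel. g2 s)"
    and nonneg: "\<And>s. g1 s \<ge> 0" "\<And>s. g2 s \<ge> 0"
    and cont: "\<And>x. isCont G1 x" "\<And>x. isCont G2 x"
    and U: "open U" "\<And>x. x \<in> {a..b} \<Longrightarrow> (G1 x, G2 x) \<in> U"
    and deriv: "\<And>z. z \<in> U \<Longrightarrow> (\<Psi> has_derivative (\<lambda>h. A z * fst h + B z * snd h)) (at z)"
    and contA: "continuous_on U A" and contB: "continuous_on U B"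
    and meas [measurable]: "(\<lambda>s. A (G1 s, G2 s)) \<in> borel_measurable borel"
      "(\<lambda>s. B (G1 s, G2 s)) \<in> borel_measurable borel"
    and ab: "a \<le> b"
  shows "set_integrable lborel {a<..b} (\<lambda>s. A (G1 s, G2 s) * g1 s + B (G1 s, G2 s) * g2 s)"
    and "(LINT s:{a<..b}|lborel. A (G1 s, G2 s) * g1 s + B (G1 s, G2 s) * g2 s)
           = \<Psi> (G1 b, G2 b) - \<Psi> (G1 a, G2 a)"
proof -
  define k where "k s = A (G1 s, G2 s) * g1 s + B (G1 s, G2 s) * g2 s" for s
  define M where "M s = G1 s + G2 s" for s
  define R where "R s = \<Psi> (G1 s, G2 s)" for s
  define P where "P \<epsilon> r t \<longleftrightarrow> set_integrable lborel {r<..t} k \<and>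
      \<bar>R t - R r - (LINT s:{r<..t}|lborel. k s)\<bar> \<le> \<epsilon> * (M t - M r)" for \<epsilon> r t
  txt \<open>\<open>P \<epsilon>\<close> is additive over adjacent intervals, so it suffices to prove it near each point; there it
    only needs the differentiability of \<open>\<Psi>\<close>, although \<open>G1\<close> and \<open>G2\<close> need not be differentiable.\<close>
  have main: "P \<epsilon> a b" if "\<epsilon> > 0" for \<epsilon>
  proof (rule Bolzano[OF ab])
    fix r x t assume P: "P \<epsilon> r x" "P \<epsilon> x t" and le: "r \<le> x" "x \<le> t"
    have un: "{r<..t} = {r<..x} \<union> {x<..t}" using le by auto
    have i: "set_integrable lborel {r<..x} k" "set_integrable lborel {x<..t} k"
      using P by (auto simp: P_def)
    have "set_integrable lborel {r<..t} k"
      unfolding un by (intro set_integrable_Un i) auto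
    moreover have "(LINT s:{r<..t}|lborel. k s) = (LINT s:{r<..x}|lborel. k s) + (LINT s:{x<..t}|lborel. k s)"
      unfolding un by (intro set_integral_Un i) auto
    ultimately show "P \<epsilon> r t"
      using P unfolding P_def by (auto simp: algebra_simps abs_le_iff)
  next
    fix x assume x: "a \<le> x" "x \<le> b"
    define z0 where "z0 = (G1 x, G2 x)"
    \<comment> \<open>Error budget, relative to the increment of \<open>M\<close>:
      \<open>2 * \<eta>\<close> for the mean value inequality applied to \<open>h\<close>, and
      \<open>\<eta>\<close> for the two integrals in which \<open>A\<close> and \<open>B\<close> are
      frozen at \<open>z0\<close>.\<close>
    define \<eta> where "\<eta> = \<epsilon> / 3"
    have \<eta>: "\<eta> > 0" using that by (simp add: \<eta>_def)
    have z0: "z0 \<in> U" using U(2) x by (simp add: z0_def)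
    obtain e0 where e0: "e0 > 0" "ball z0 e0 \<subseteq> U" using U(1) z0 open_contains_ball by blast
    obtain eA where eA: "eA > 0" "\<And>z. z \<in> U \<Longrightarrow> dist z z0 < eA \<Longrightarrow> \<bar>A z - A z0\<bar> < \<eta>"
      using contA z0 \<eta> unfolding continuous_on_iff dist_real_def by metis
    obtain eB where eB: "eB > 0" "\<And>z. z \<in> U \<Longrightarrow> dist z z0 < eB \<Longrightarrow> \<bar>B z - B z0\<bar> < \<eta>"
      using contB z0 \<eta> unfolding continuous_on_iff dist_real_def by metis
    define e where "e = min e0 (min eA eB)"
    have e: "e > 0" using e0 eA eB by (simp add: e_def)
    have close: "z \<in> U" "\<bar>A z - A z0\<bar> \<le> \<eta>" "\<bar>B z - B z0\<bar> \<le> \<eta>" if "z \<in> ball z0 e" for z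
      using that e0(2) eA(2)[of z] eB(2)[of z] by (auto simp: e_def dist_commute less_imp_le)
    have "isCont (\<lambda>s. (G1 s, G2 s)) x" using cont[of x] by (intro continuous_Pair)
    then obtain d where d: "d > 0" "\<And>s. \<bar>s - x\<bar> < d \<Longrightarrow> (G1 s, G2 s) \<in> ball z0 e"
      using e unfolding continuous_at_eps_delta z0_def
      by (metis mem_ball dist_commute dist_real_def)
    show "\<exists>d>0. \<forall>r t. r \<le> x \<and> x \<le> t \<and> t - r < d \<longrightarrow> P \<epsilon> r t"
    proof (intro exI[of _ d] conjI d allI impI; elim conjE)
      fix r t assume rt: "r \<le> x" "x \<le> t" "t - r < d"
      have le: "r \<le> t" using rt by simp
      have inb: "(G1 s, G2 s) \<in> ball z0 e" if "s \<in> {r..t}" for s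
        using that rt by (intro d) auto
      have mono: "G1 r \<le> G1 t" "G2 r \<le> G2 t"
        using G1[OF le] G2[OF le] set_integral_nonneg[of "{r<..t}" g1 lborel]
          set_integral_nonneg[of "{r<..t}" g2 lborel] nonneg by auto
      \<comment> \<open>Removing the linear part at \<open>z0\<close> leaves a function whose
        derivative has operator norm at most \<open>2 * \<eta>\<close> on the ball.\<close>
      define h where "h z = \<Psi> z - (A z0 * fst z + B z0 * snd z)" for z
      have "norm (h (G1 t, G2 t) - h (G1 r, G2 r)) \<le> (2 * \<eta>) * norm ((G1 t, G2 t) - (G1 r, G2 r))"
      proof (rule differentiable_bound[where S = "ball z0 e" and f' = "\<lambda>z v. (A z - A z0) * fst v + (B z - B z0) * snd v"])
        fix z assume z: "z \<in> ball z0 e"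
        have "(h has_derivative (\<lambda>v. A z * fst v + B z * snd v - (A z0 * fst v + B z0 * snd v))) (at z)"
          unfolding h_def
          by (intro has_derivative_diff deriv close(1)[OF z] has_derivative_add has_derivative_mult_right
              has_derivative_fst has_derivative_snd has_derivative_ident)
        moreover have "A z * fst v + B z * snd v - (A z0 * fst v + B z0 * snd v)
            = (A z - A z0) * fst v + (B z - B z0) * snd v" for v
          by (simp add: left_diff_distrib)
        ultimately have "(h has_derivative (\<lambda>v. (A z - A z0) * fst v + (B z - B z0) * snd v)) (at z)"
          by (simp only:)
        then show "(h has_derivative (\<lambda>v. (A z - A z0) * fst v + (B z - B z0) * snd v)) (at z within ball z0 e)"
          by (rule has_derivative_at_withinI)
        show "onorm (\<lambda>v. (A z - A z0) * fst v + (B z - B z0) * snd v) \<le> 2 * \<eta>"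
        proof (rule onorm_le)
          fix v :: "real \<times> real"
          have "\<bar>fst v\<bar> \<le> norm v" "\<bar>snd v\<bar> \<le> norm v"
            by (metis norm_fst_le prod.collapse real_norm_def, metis norm_snd_le prod.collapse real_norm_def)
          then have "\<bar>A z - A z0\<bar> * \<bar>fst v\<bar> \<le> \<eta> * norm v" "\<bar>B z - B z0\<bar> * \<bar>snd v\<bar> \<le> \<eta> * norm v"
            using close[OF z] \<eta> by (auto intro!: mult_mono)
          then show "norm ((A z - A z0) * fst v + (B z - B z0) * snd v) \<le> 2 * \<eta> * norm v"
            using abs_triangle_ineq[of "(A z - A z0) * fst v" "(B z - B z0) * snd v"]
            by (simp add: abs_mult)
        qed
      qed (use inb le in auto)
      also have "norm ((G1 t, G2 t) - (G1 r, G2 r)) \<le> M t - M r"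
        using norm_Pair_le[of "G1 t - G1 r" "G2 t - G2 r"] mono by (simp add: M_def)
      finally have 1: "\<bar>R t - R r - (A z0 * (G1 t - G1 r) + B z0 * (G2 t - G2 r))\<bar> \<le> 2 * \<eta> * (M t - M r)"
        using \<eta> by (simp add: h_def R_def algebra_simps)
      \<comment> \<open>Freezing the coefficient at \<open>z0\<close> costs at most
        \<open>\<eta>\<close> times the increment, because the density is nonnegative and integrates
        to that increment.\<close>
      have aux: "set_integrable lborel {r<..t} (\<lambda>s. c (G1 s, G2 s) * g s)
          \<and> \<bar>(LINT s:{r<..t}|lborel. c (G1 s, G2 s) * g s) - c z0 * (G t - G r)\<bar> \<le> \<eta> * (G t - G r)"
        if [measurable]: "(\<lambda>s. c (G1 s, G2 s)) \<in> borel_measurable borel" 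
          and ig: "set_integrable lborel {r<..t} g" and g0: "\<And>s. g s \<ge> 0"
          and Gg: "G t - G r = (LINT s:{r<..t}|lborel. g s)"
          and c: "\<And>z. z \<in> ball z0 e \<Longrightarrow> \<bar>c z - c z0\<bar> \<le> \<eta>" for c :: "real \<times> real \<Rightarrow> real" and g G
      proof -
        have id: "set_integrable lborel {r<..t} (\<lambda>s. (c (G1 s, G2 s) - c z0) * g s)"
          unfolding set_integrable_def
        proof (rule Bochner_Integration.integrable_bound)
          show "integrable lborel (\<lambda>s. \<eta> * (indicat_real {r<..t} s *\<^sub>R g s))"
            using ig unfolding set_integrable_def by (rule integrable_mult_right)
          have [measurable]: "(\<lambda>s. indicat_real {r<..t} s *\<^sub>R g s) \<in> borel_measurable lborel"
            using ig unfolding set_integrable_def by auto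
          have "(\<lambda>s. (c (G1 s, G2 s) - c z0) * (indicat_real {r<..t} s *\<^sub>R g s)) \<in> borel_measurable lborel"
            by measurable
          then show "(\<lambda>s. indicat_real {r<..t} s *\<^sub>R ((c (G1 s, G2 s) - c z0) * g s)) \<in> borel_measurable lborel"
            by (simp add: mult_ac)
          show "AE s in lborel. norm (indicat_real {r<..t} s *\<^sub>R ((c (G1 s, G2 s) - c z0) * g s))
              \<le> norm (\<eta> * (indicat_real {r<..t} s *\<^sub>R g s))"
            using c inb g0 \<eta> by (intro AE_I2) (auto simp: abs_mult indicator_def intro!: mult_mono)
        qed
        have ic: "set_integrable lborel {r<..t} (\<lambda>s. c z0 * g s)" using ig by simp
        have eq: "c (G1 s, G2 s) * g s = (c (G1 s, G2 s) - c z0) * g s + c z0 * g s" for s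
          by (simp add: algebra_simps)
        have "set_integrable lborel {r<..t} (\<lambda>s. c (G1 s, G2 s) * g s)"
          unfolding eq using id ic by (rule set_integral_add)
        moreover have "(LINT s:{r<..t}|lborel. c (G1 s, G2 s) * g s)
            = (LINT s:{r<..t}|lborel. (c (G1 s, G2 s) - c z0) * g s) + c z0 * (G t - G r)"
          unfolding eq using id ic by (simp add: set_integral_add Gg)
        moreover have "\<bar>LINT s:{r<..t}|lborel. (c (G1 s, G2 s) - c z0) * g s\<bar> \<le> (LINT s:{r<..t}|lborel. \<eta> * g s)"
        proof -
          have "\<bar>LINT s:{r<..t}|lborel. (c (G1 s, G2 s) - c z0) * g s\<bar>
              \<le> (LINT s:{r<..t}|lborel. \<bar>(c (G1 s, G2 s) - c z0) * g s\<bar>)"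
            using set_integral_norm_bound[OF id] by simp
          also have "\<dots> \<le> (LINT s:{r<..t}|lborel. \<eta> * g s)"
          proof (rule set_integral_mono)
            show "set_integrable lborel {r<..t} (\<lambda>s. \<bar>(c (G1 s, G2 s) - c z0) * g s\<bar>)"
              by (rule set_integrable_abs[OF id])
          qed (use ig c inb g0 in \<open>auto simp: abs_mult intro!: mult_right_mono\<close>)
          finally show ?thesis .
        qed
        ultimately show ?thesis by (simp add: Gg)
      qed
      have 2: "set_integrable lborel {r<..t} (\<lambda>s. A (G1 s, G2 s) * g1 s)"
        "\<bar>(LINT s:{r<..t}|lborel. A (G1 s, G2 s) * g1 s) - A z0 * (G1 t - G1 r)\<bar> \<le> \<eta> * (G1 t - G1 r)"
        using aux[of A g1 G1] int1[OF le] G1[OF le] nonneg close by auto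
      have 3: "set_integrable lborel {r<..t} (\<lambda>s. B (G1 s, G2 s) * g2 s)"
        "\<bar>(LINT s:{r<..t}|lborel. B (G1 s, G2 s) * g2 s) - B z0 * (G2 t - G2 r)\<bar> \<le> \<eta> * (G2 t - G2 r)"
        using aux[of B g2 G2] int2[OF le] G2[OF le] nonneg close by auto
      have "set_integrable lborel {r<..t} k"
        unfolding k_def using 2(1) 3(1) by (rule set_integral_add)
      moreover have "(LINT s:{r<..t}|lborel. k s)
          = (LINT s:{r<..t}|lborel. A (G1 s, G2 s) * g1 s) + (LINT s:{r<..t}|lborel. B (G1 s, G2 s) * g2 s)"
        unfolding k_def using 2(1) 3(1) by (rule set_integral_add)
      moreover have "\<epsilon> * (M t - M r) = 2 * \<eta> * (M t - M r) + \<eta> * (G1 t - G1 r) + \<eta> * (G2 t - G2 r)"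
        by (simp add: \<eta>_def M_def field_simps)
      ultimately show "P \<epsilon> r t"
        unfolding P_def using 1 2(2) 3(2) by (auto simp: abs_le_iff)
    qed
  qed
  show "set_integrable lborel {a<..b} (\<lambda>s. A (G1 s, G2 s) * g1 s + B (G1 s, G2 s) * g2 s)"
    using main[of 1] unfolding P_def k_def by simp
  have "\<bar>R b - R a - (LINT s:{a<..b}|lborel. k s)\<bar> \<le> 0"
  proof (rule field_le_epsilon)
    fix e :: real assume e: "e > 0"
    have M: "M b - M a \<ge> 0"
      using G1[OF ab] G2[OF ab] set_integral_nonneg[of "{a<..b}" g1 lborel]
        set_integral_nonneg[of "{a<..b}" g2 lborel] nonneg by (auto simp: M_def)
    \<comment> \<open>The extra 1 in the denominator covers the case that \<open>M\<close> is
      constant on the interval.\<close>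
    have "\<bar>R b - R a - (LINT s:{a<..b}|lborel. k s)\<bar> \<le> e / (M b - M a + 1) * (M b - M a)"
      using main[of "e / (M b - M a + 1)"] e M by (simp add: P_def)
    also have "\<dots> \<le> e" using e M by (simp add: field_simps)
    finally show "\<bar>R b - R a - (LINT s:{a<..b}|lborel. k s)\<bar> \<le> 0 + e" by simp
  qed
  then show "(LINT s:{a<..b}|lborel. A (G1 s, G2 s) * g1 s + B (G1 s, G2 s) * g2 s)
           = \<Psi> (G1 b, G2 b) - \<Psi> (G1 a, G2 a)"
    by (simp add: k_def R_def)
qed

section \<open>The monotone coupling and the entropy\<close>

context real_distribution
begin

lemma cdf_attains:
  assumes cont: "\<And>x. isCont (cdf M) x" and t: "0 < t" "t < 1"
  obtains x where "cdf M x = t"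
proof -
  have "eventually (\<lambda>x. cdf M x < t) at_bot" "eventually (\<lambda>x. t < cdf M x) at_top"
    using order_tendstoD[OF cdf_lim_at_bot] order_tendstoD[OF cdf_lim_at_top_prob] t by auto
  then obtain a b where "cdf M a < t" "t < cdf M b"
    by (auto simp: eventually_at_bot_linorder eventually_at_top_linorder)
  moreover from this have "a \<le> b"
    using cdf_nondecreasing[of b a] by linarith
  ultimately have "\<exists>x. a \<le> x \<and> x \<le> b \<and> cdf M x = t"
    using cont by (intro IVT) auto
  then show ?thesis using that by auto
qed

lemma cdf_measurable [measurable]: "cdf M \<in> borel_measurable borel"
  by (intro borel_measurable_mono monoI cdf_nondecreasing)

text \<open>The probability integral transform. The set is compared with half-lines ending where
  \<open>cdf M\<close> equals a level \<open>s\<close> on either side of \<open>t\<close>; strict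
  inequality between the levels gives the inclusions even on flat pieces, and covers the values 0
  and 1, which may not be attained.\<close>

lemma measure_cdf_le:
  assumes cont: "\<And>x. isCont (cdf M) x" and t: "0 \<le> t" "t \<le> 1"
  shows "measure M {x. cdf M x \<le> t} = t"
proof (rule antisym)
  show "measure M {x. cdf M x \<le> t} \<le> t"
  proof (rule dense_ge)
    fix s assume s: "t < s"
    show "measure M {x. cdf M x \<le> t} \<le> s"
    proof (cases "s < 1")
      case True
      then obtain y where y: "cdf M y = s" using cdf_attains[OF cont, of s] t s by auto
      have "x \<le> y" if "cdf M x \<le> t" for x
        using that cdf_nondecreasing[of y x] y s by linarith
      then have "{x. cdf M x \<le> t} \<subseteq> {..y}" by blast
      then have "measure M {x. cdf M x \<le> t} \<le> measure M {..y}"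
        by (intro finite_measure_mono) auto
      then show ?thesis using y by (simp add: cdf_def)
    next
      case False
      then show ?thesis using prob_le_1[of "{x. cdf M x \<le> t}"] by linarith
    qed
  qed
  show "t \<le> measure M {x. cdf M x \<le> t}"
  proof (rule dense_le)
    fix s assume s: "s < t"
    show "s \<le> measure M {x. cdf M x \<le> t}"
    proof (cases "s > 0")
      case True
      then obtain y where y: "cdf M y = s" using cdf_attains[OF cont, of s] t s by auto
      have "{..y} \<subseteq> {x. cdf M x \<le> t}"
        using cdf_nondecreasing[of _ y] y s by force
      then have "measure M {..y} \<le> measure M {x. cdf M x \<le> t}"
        by (intro finite_measure_mono) auto
      then show ?thesis using y by (simp add: cdf_def)
    next
      case False
      then show ?thesis using measure_nonneg[of M "{x. cdf M x \<le> t}"] by linarith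
    qed
  qed
qed

text \<open>The distribution function of \<open>\<nu>\<close> can be 0 or 1 on whole half-lines;
  this result ensures that its logarithm and that of its complement are taken at positive arguments
  almost everywhere.\<close>

lemma AE_cdf_in_unit:
  assumes cont: "\<And>x. isCont (cdf M) x"
  shows "AE x in M. 0 < cdf M x \<and> cdf M x < 1"
proof -
  have "emeasure M {x. cdf M x \<le> 0} = 0"
    using measure_cdf_le[OF cont, of 0] by (simp add: emeasure_eq_measure)
  then have 0: "AE x in M. 0 < cdf M x"
    by (intro AE_I[where N = "{x. cdf M x \<le> 0}"]) auto
  have "AE x in M. cdf M x \<noteq> 1"
  proof -
    have "measure M {x. cdf M x = 1} \<le> 0"
    proof (rule field_le_epsilon)
      fix e :: real assume e: "e > 0"
      define s where "s = max 0 (1 - e)"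
      have s: "0 \<le> s" "s < 1" "1 - s \<le> e" using e by (auto simp: s_def)
      have "measure M {x. cdf M x = 1} \<le> measure M (UNIV - {x. cdf M x \<le> s})"
        using s by (intro finite_measure_mono) auto
      also have "\<dots> = 1 - s"
        using prob_compl[of "{x. cdf M x \<le> s}"] measure_cdf_le[OF cont, of s] s by simp
      finally show "measure M {x. cdf M x = 1} \<le> 0 + e" using s by simp
    qed
    then have "emeasure M {x. cdf M x = 1} = 0"
      using measure_nonneg[of M "{x. cdf M x = 1}"] by (simp add: emeasure_eq_measure)
    then show ?thesis by (intro AE_I[where N = "{x. cdf M x = 1}"]) auto
  qed
  with 0 show ?thesis
  proof eventually_elim
    case (elim x)
    then show ?case using cdf_bounded_prob[of x] by auto
  qed
qed

end

section \<open>Laws on the line given by a density\<close>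

lemma real_distribution_density:
  assumes "prob_space (density lborel f)"
  shows "real_distribution (density lborel f)"
  using assms by (simp add: real_distribution_def real_distribution_axioms_def)

lemma integrable_prob_density:
  fixes g :: "real \<Rightarrow> real"
  assumes [measurable]: "g \<in> borel_measurable borel" and "\<And>x. 0 \<le> g x"
    and "prob_space (density lborel (\<lambda>x. ennreal (g x)))"
  shows "integrable lborel g" "(LINT x|lborel. g x) = 1"
proof -
  have "(\<integral>\<^sup>+x. ennreal (g x) \<partial>lborel) = 1"
    using prob_space.emeasure_space_1[OF assms(3)] by (simp add: emeasure_density)
  then show "integrable lborel g" "(LINT x|lborel. g x) = 1"
    using assms(2) nn_integral_eq_integrable[of g lborel 1] by auto
qed

lemma measure_density_eq_set_integral:
  fixes g :: "real \<Rightarrow> real"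
  assumes [measurable]: "g \<in> borel_measurable borel" and "\<And>x. 0 \<le> g x"
    and "prob_space (density lborel (\<lambda>x. ennreal (g x)))" and [measurable]: "A \<in> sets borel"
  shows "measure (density lborel (\<lambda>x. ennreal (g x))) A = (LINT x:A|lborel. g x)"
proof -
  interpret prob_space "density lborel (\<lambda>x. ennreal (g x))" by fact
  have "measure (density lborel (\<lambda>x. ennreal (g x))) A
      = (LINT x|density lborel (\<lambda>x. ennreal (g x)). indicator A x)"
    by simp
  also have "\<dots> = (LINT x:A|lborel. g x)"
    unfolding set_lebesgue_integral_def using assms(2)
    by (subst integral_density) (auto simp: mult.commute)
  finally show ?thesis .
qed

lemma set_integrable_prob_density:
  fixes g :: "real \<Rightarrow> real"
  assumes "g \<in> borel_measurable borel" "\<And>x. 0 \<le> g x"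
    and "prob_space (density lborel (\<lambda>x. ennreal (g x)))" and "A \<in> sets borel"
  shows "set_integrable lborel A g"
  using integrable_prob_density(1)[OF assms(1-3)] assms(4)
  by (auto simp: set_integrable_def intro: integrable_mult_indicator[where 'b = real, simplified])

lemma cdf_density_diff:
  fixes g :: "real \<Rightarrow> real"
  assumes g: "g \<in> borel_measurable borel" "\<And>x. 0 \<le> g x"
    and p: "prob_space (density lborel (\<lambda>x. ennreal (g x)))" and le: "a \<le> b"
  shows "cdf (density lborel (\<lambda>x. ennreal (g x))) b - cdf (density lborel (\<lambda>x. ennreal (g x))) a
       = (LINT x:{a<..b}|lborel. g x)"
proof -
  interpret real_distribution "density lborel (\<lambda>x. ennreal (g x))"
    by (rule real_distribution_density[OF p])
  show ?thesis
    using le cdf_diff_eq[of a b] measure_density_eq_set_integral[OF g p, of "{a<..b}"]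
    by (cases "a = b") auto
qed

lemma isCont_cdf_density:
  fixes g :: "real \<Rightarrow> real"
  assumes g: "g \<in> borel_measurable borel" "\<And>x. 0 \<le> g x"
    and p: "prob_space (density lborel (\<lambda>x. ennreal (g x)))"
  shows "isCont (cdf (density lborel (\<lambda>x. ennreal (g x)))) x"
proof -
  interpret real_distribution "density lborel (\<lambda>x. ennreal (g x))"
    by (rule real_distribution_density[OF p])
  have "AE y in lborel. y \<noteq> x" by (rule AE_lborel_singleton)
  then have "(LINT y:{x}|lborel. g y) = 0"
    unfolding set_lebesgue_integral_def by (intro integral_eq_zero_AE) auto
  then show ?thesis
    using measure_density_eq_set_integral[OF g p, of "{x}"] by (simp add: isCont_cdf)
qed

section \<open>The truncated cost and pointwise entropy inequalities\<close>

text \<open>A smooth function comparable to the minimum of \<open>w\<^sup>2\<close> and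
  \<open>\<bar>w\<bar>\<close>. Smoothness makes it fit for the chain rule, and its derivative
  \<open>w / sqrt (1 + w\<^sup>2)\<close> lies between -1 and 1.\<close>

definition trunc_cost :: "real \<Rightarrow> real" where
  "trunc_cost w = sqrt (1 + w\<^sup>2) - 1"

lemma trunc_cost_nonneg: "0 \<le> trunc_cost w"
  by (simp add: trunc_cost_def)

lemma trunc_cost_le_abs: "trunc_cost w \<le> \<bar>w\<bar>"
proof -
  have "sqrt (1 + w\<^sup>2) \<le> 1 + \<bar>w\<bar>"
    by (rule real_le_lsqrt) (auto simp: power2_sum)
  then show ?thesis by (simp add: trunc_cost_def)
qed

text \<open>Allows an error quadratic in the derivative of the cost to be absorbed by the cost
  itself. With \<open>s = sqrt (1 + w\<^sup>2)\<close> it amounts to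
  \<open>(s - 1) * (2 * s\<^sup>2 - s - 1) \<ge> 0\<close>.\<close>

lemma trunc_cost_ge_deriv_sq: "(w / sqrt (1 + w\<^sup>2))\<^sup>2 / 2 \<le> trunc_cost w"
proof -
  define s where "s = sqrt (1 + w\<^sup>2)"
  have s: "s \<ge> 1" "w\<^sup>2 = s\<^sup>2 - 1" by (auto simp: s_def)
  have "(s\<^sup>2 - 1) / (2 * s\<^sup>2) \<le> s - 1"
  proof -
    have "s * 1 \<le> s * s" using s by (intro mult_left_mono) auto
    then have "0 \<le> 2 * s\<^sup>2 - s - 1" using s(1) unfolding power2_eq_square by linarith
    then have "0 \<le> (s - 1) * (2 * s\<^sup>2 - s - 1)"
      using s(1) by (intro mult_nonneg_nonneg) auto
    then show ?thesis using s by (simp add: field_simps power2_eq_square)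
  qed
  then show ?thesis using s by (simp add: trunc_cost_def power_divide flip: s_def)
qed

text \<open>With \<open>s = sqrt r\<close>, the entropy term is at least
  \<open>(s - 1)\<^sup>2\<close>, a Hellinger-type bound. Completing the square in \<open>d\<close>
  leaves \<open>9 * (s - 1)\<^sup>2 - ((s - 1) * (s + 1) / s)\<^sup>2\<close>, which is nonnegative
  for \<open>s \<ge> 1 / 2\<close> since then \<open>s + 1 \<le> 3 * s\<close>; hence the 9. For
  smaller \<open>s\<close> the entropy term alone dominates \<open>d * (r - 1)\<close>.\<close>

lemma entropy_quadratic_bound:
  fixes r d :: real
  assumes r: "0 \<le> r" and d: "\<bar>d\<bar> \<le> 1"
  shows "0 \<le> 9 * (r * ln r - r + 1) + d\<^sup>2 * r / 4 + d * (r - 1)"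
proof -
  define s where "s = sqrt r"
  have s: "s \<ge> 0" "r = s\<^sup>2" using r by (auto simp: s_def)
  have ent: "(s - 1)\<^sup>2 \<le> r * ln r - r + 1"
  proof (cases "s = 0")
    case False
    then have "ln (1 / s) \<le> 1 / s - 1" using s by (intro ln_le_minus_one) auto
    then have "2 * s\<^sup>2 * (1 - 1 / s) \<le> 2 * s\<^sup>2 * ln s"
      using False s by (intro mult_left_mono) (auto simp: ln_div)
    moreover have "2 * s\<^sup>2 * (1 - 1 / s) = 2 * s\<^sup>2 - 2 * s"
      using False by (simp add: field_simps power2_eq_square)
    moreover have "ln r = 2 * ln s" using s False by (simp add: ln_realpow)
    ultimately have "2 * s\<^sup>2 - 2 * s \<le> r * ln r" using s by simp
    then show ?thesis using s by (simp add: power2_eq_square algebra_simps)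
  qed (use s in auto)
  have "0 \<le> 9 * (s - 1)\<^sup>2 + d\<^sup>2 * r / 4 + d * (r - 1)"
  proof (cases "s \<le> 1 / 2")
    case True
    have "(1/2)\<^sup>2 \<le> (1 - s)\<^sup>2" using True by (intro power_mono) auto
    then have "9 * (s - 1)\<^sup>2 \<ge> 1" by (simp add: power2_eq_square algebra_simps)
    moreover have "\<bar>d * (r - 1)\<bar> \<le> 1 * 1"
      unfolding abs_mult using d s True power_mono[of s "1/2" 2]
      by (intro mult_mono) (auto simp: power2_eq_square)
    moreover have "0 \<le> d\<^sup>2 * r / 4" using r by simp
    ultimately show ?thesis by linarith
  next
    case False
    have "(s + 1)\<^sup>2 \<le> (3 * s)\<^sup>2" using False by (intro power_mono) auto
    then have "(s - 1)\<^sup>2 * (s + 1)\<^sup>2 \<le> (s - 1)\<^sup>2 * (3 * s)\<^sup>2" by (intro mult_left_mono) auto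
    then have "0 \<le> 9 * (s - 1)\<^sup>2 * s\<^sup>2 - ((s - 1) * (s + 1))\<^sup>2"
      unfolding power_mult_distrib by simp
    also have "\<dots> \<le> 9 * (s - 1)\<^sup>2 * s\<^sup>2 - ((s - 1) * (s + 1))\<^sup>2 + (d * s\<^sup>2 / 2 + (s - 1) * (s + 1))\<^sup>2"
      by simp
    also have "\<dots> = s\<^sup>2 * (9 * (s - 1)\<^sup>2 + d\<^sup>2 * s\<^sup>2 / 4 + d * (s\<^sup>2 - 1))"
      by (simp add: power2_eq_square algebra_simps)
    finally show ?thesis using False s by (simp add: zero_le_mult_iff)
  qed
  also have "\<dots> \<le> 9 * (r * ln r - r + 1) + d\<^sup>2 * r / 4 + d * (r - 1)"
    using ent by simp
  finally show ?thesis .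
qed

text \<open>With \<open>f = d\<nu>/d\<mu>\<close> and \<open>w = ln (G / F)\<close>, the first two terms on the left are the density with
  respect to \<open>\<mu>\<close> of the exact differential of \<open>G (w - c(w) / 9)\<close>.\<close>
lemma entropy_pointwise_bound:
  fixes f w :: real
  assumes f: "0 \<le> f"
  defines "d \<equiv> w / sqrt (1 + w\<^sup>2)"
  shows "f * (w - trunc_cost w / 9) + (1 - d / 9) * (f - exp w) + trunc_cost w * f / 18 \<le> f * ln f"
proof -
  \<comment> \<open>By homogeneity \<open>f\<close> is measured in units of \<open>exp w\<close>,
    the value at which the entropy remainder vanishes.\<close>
  define r where "r = f / exp w"
  have fr: "f = exp w * r" and r: "r \<ge> 0" using f by (auto simp: r_def)
  have "\<bar>w\<bar> \<le> sqrt (1 + w\<^sup>2)" by (rule real_le_rsqrt) simp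
  moreover have "0 < sqrt (1 + w\<^sup>2)" by (simp add: add_pos_nonneg)
  ultimately have d: "\<bar>d\<bar> \<le> 1" unfolding d_def abs_divide by simp
  \<comment> \<open>So the loss \<open>d\<^sup>2 * r / 4\<close> is at most
    \<open>trunc_cost w * r / 2\<close>. After division by 9 it uses half of the term
    \<open>trunc_cost w * f / 9\<close> in the exact differential; the other half is the gain with
    the factor 1/18.\<close>
  have "d\<^sup>2 / 2 * r \<le> trunc_cost w * r"
    using trunc_cost_ge_deriv_sq[of w] r unfolding d_def by (intro mult_right_mono)
  then have "0 \<le> 9 * (r * ln r - r + 1) + trunc_cost w * r / 2 + d * (r - 1)"
    using entropy_quadratic_bound[OF r d] by simp
  then have "0 \<le> exp w * (9 * (r * ln r - r + 1) + trunc_cost w * r / 2 + d * (r - 1))"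
    by simp
  moreover have "f * ln f = exp w * (r * w + r * ln r)"
  proof (cases "r = 0")
    case False
    then have "ln f = w + ln r" using r by (simp add: fr ln_mult)
    then show ?thesis by (simp add: fr algebra_simps)
  qed (simp add: fr)
  ultimately have "0 \<le> 9 * (f * ln f) - 9 * f * w + 9 * (exp w - f) + trunc_cost w * f / 2 + d * (f - exp w)"
    by (simp add: fr algebra_simps)
  then show ?thesis by (simp add: field_simps)
qed

section \<open>A one-sided entropy bound for ratios of distribution functions\<close>

lemma cdf_density_strict_mono:
  fixes p :: "real \<Rightarrow> real"
  assumes p: "p \<in> borel_measurable borel" "\<And>x. 0 < p x"
    and prob: "prob_space (density lborel (\<lambda>x. ennreal (p x)))" and less: "a < b"
  shows "cdf (density lborel (\<lambda>x. ennreal (p x))) a < cdf (density lborel (\<lambda>x. ennreal (p x))) b"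
proof -
  let ?M = "density lborel (\<lambda>x. ennreal (p x))"
  interpret real_distribution ?M by (rule real_distribution_density[OF prob])
  note [measurable] = p(1)
  have "emeasure ?M {a<..b} \<noteq> 0"
  proof
    assume "emeasure ?M {a<..b} = 0"
    then have "AE x in lborel. ennreal (p x) * indicator {a<..b} x = 0"
      by (simp add: emeasure_density nn_integral_0_iff_AE)
    moreover have "ennreal (p x) \<noteq> 0" for x using p(2)[of x] by simp
    ultimately have "AE x in lborel. x \<notin> {a<..b}"
      by (auto simp: indicator_def split: if_splits)
    then have "emeasure lborel {a<..b} = 0"
      by (subst (asm) AE_iff_measurable[of "{a<..b}"]) auto
    then show False using less by simp
  qed
  then have "measure ?M {a<..b} > 0"
    by (simp add: emeasure_eq_measure zero_less_measure_iff)
  then show ?thesis using cdf_diff_eq[OF less] by simp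
qed

lemma cdf_density_in_unit:
  fixes p :: "real \<Rightarrow> real"
  assumes p: "p \<in> borel_measurable borel" "\<And>x. 0 < p x"
    and prob: "prob_space (density lborel (\<lambda>x. ennreal (p x)))"
  shows "0 < cdf (density lborel (\<lambda>x. ennreal (p x))) x" "cdf (density lborel (\<lambda>x. ennreal (p x))) x < 1"
proof -
  interpret real_distribution "density lborel (\<lambda>x. ennreal (p x))"
    by (rule real_distribution_density[OF prob])
  show "0 < cdf (density lborel (\<lambda>x. ennreal (p x))) x"
    using cdf_density_strict_mono[OF assms, of "x - 1" x] cdf_nonneg[of "x - 1"] by linarith
  show "cdf (density lborel (\<lambda>x. ennreal (p x))) x < 1"
    using cdf_density_strict_mono[OF assms, of x "x + 1"] cdf_bounded_prob[of "x + 1"] by linarith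
qed

text \<open>Young's inequality for the entropy: \<open>ln t \<le> t - 1\<close> at
  \<open>t = exp w * p / g\<close>, with equality for \<open>g = exp w * p\<close>. With
  \<open>w\<close> constant, integrating it over a set bounds the entropy there by masses
  alone.\<close>

lemma entropy_ge_affine:
  fixes g p w :: real
  assumes g: "0 \<le> g" and p: "0 < p"
  shows "g * w + g - exp w * p \<le> g * ln (g / p)"
proof (cases "g = 0")
  case False
  with g have g: "g > 0" by simp
  have "ln (exp w * p / g) \<le> exp w * p / g - 1"
    using g p by (intro ln_le_minus_one) auto
  then have "g * (w - ln (g / p)) \<le> g * (exp w * p / g - 1)"
    using g p by (intro mult_left_mono) (auto simp: ln_mult ln_div)
  then show ?thesis using g by (simp add: algebra_simps)
qed (use p in auto)

text \<open>The pointwise bound is integrated over \<open>{a<..b}\<close>, where the exact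
  differential contributes boundary values of \<open>R\<close>; outside, Young's inequality bounds
  the entropy from below. Then the intervals exhaust the set where \<open>G > 0\<close>. The factor
  18 is that of the pointwise bound.\<close>

lemma cdf_ratio_cost_le_entropy:
  fixes p g :: "real \<Rightarrow> real"
  defines "M \<equiv> density lborel (\<lambda>x. ennreal (p x))" and "N \<equiv> density lborel (\<lambda>x. ennreal (g x))"
  assumes p [measurable]: "p \<in> borel_measurable borel" and p_pos: "\<And>x. 0 < p x"
    and g [measurable]: "g \<in> borel_measurable borel" and g_nonneg: "\<And>x. 0 \<le> g x"
    and prob: "prob_space M" "prob_space N"
    and ent: "integrable lborel (\<lambda>x. g x * ln (g x / p x))"
  shows "(\<integral>\<^sup>+x. ennreal (trunc_cost (ln (cdf N x) - ln (cdf M x))) \<partial>N)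
      \<le> ennreal (18 * (LINT x|lborel. g x * ln (g x / p x)))"
proof -
  interpret M: real_distribution M unfolding M_def
    by (rule real_distribution_density) (use prob in \<open>simp add: M_def\<close>)
  interpret N: real_distribution N unfolding N_def
    by (rule real_distribution_density) (use prob in \<open>simp add: N_def\<close>)
  define F where "F = cdf M"
  define G where "G = cdf N"
  have p_nonneg: "0 \<le> p x" for x using p_pos[of x] by simp
  have [measurable]: "F \<in> borel_measurable borel" "G \<in> borel_measurable borel"
    unfolding F_def G_def by measurable
  have contF: "isCont F x" for x
    using isCont_cdf_density[OF p p_nonneg] prob(1) by (simp add: F_def M_def)
  have contG: "isCont G x" for x
    using isCont_cdf_density[OF g g_nonneg] prob(2) by (simp add: G_def N_def)
  have F_pos: "0 < F x" for x
    using cdf_density_in_unit[OF p p_pos] prob(1) by (simp add: F_def M_def)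
  have G_mono: "G x \<le> G y" if "x \<le> y" for x y
    using N.cdf_nondecreasing[OF that] by (simp add: G_def)
  define w where "w x = ln (G x) - ln (F x)" for x
  define E where "E x = g x * ln (g x / p x)" for x
  define H where "H = (LINT x|lborel. E x)"
  have [measurable]: "w \<in> borel_measurable borel" "E \<in> borel_measurable borel"
    unfolding w_def E_def by measurable
  have [measurable]: "trunc_cost \<in> borel_measurable borel"
    unfolding trunc_cost_def by measurable
  have E_int: "set_integrable lborel A E" if "A \<in> sets borel" for A
    using ent that unfolding set_integrable_def E_def
    by (auto intro: integrable_mult_indicator[where 'b = real, simplified])
  have E_lower: "c * measure N A + measure N A - exp c * measure M A \<le> (LINT x:A|lborel. E x)"
    if [measurable]: "A \<in> sets borel" for A c
  proof -
    have i: "set_integrable lborel A g" "set_integrable lborel A p"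
      using set_integrable_prob_density[OF g g_nonneg] set_integrable_prob_density[OF p p_nonneg] prob
      by (auto simp: M_def N_def)
    have "c * measure N A + measure N A - exp c * measure M A
        = (LINT x:A|lborel. c * g x + g x - exp c * p x)"
      using i measure_density_eq_set_integral[OF g g_nonneg] measure_density_eq_set_integral[OF p p_nonneg] prob
      by (simp add: M_def N_def set_integral_add set_integral_diff)
    also have "\<dots> \<le> (LINT x:A|lborel. E x)"
      using entropy_ge_affine[OF g_nonneg p_pos] i
      by (intro set_integral_mono E_int) (auto simp: E_def mult.commute intro!: set_integral_add set_integral_diff)
    finally show ?thesis .
  qed
  define d where "d v = v / sqrt (1 + v\<^sup>2)" for v :: real
  define q where "q v = v - trunc_cost v / 9" for v
  \<comment> \<open>\<open>A\<close> and \<open>B\<close> are the partial derivatives of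
    \<open>\<Psi>\<close> in the variables \<open>G\<close> and \<open>F\<close> on the open
    quadrant \<open>U\<close>, and \<open>R\<close> is \<open>\<Psi>\<close> along the curve
    \<open>(G, F)\<close>.\<close>
  define \<Psi> where "\<Psi> z = fst z * q (ln (fst z) - ln (snd z))" for z
  define A where "A z = q (ln (fst z) - ln (snd z)) + (1 - d (ln (fst z) - ln (snd z)) / 9)" for z
  define B where "B z = - (fst z / snd z) * (1 - d (ln (fst z) - ln (snd z)) / 9)" for z
  define U where "U = {z::real \<times> real. 0 < fst z} \<inter> {z. 0 < snd z}"
  define R where "R x = G x * q (w x)" for x
  have q_deriv: "(q has_real_derivative 1 - d v / 9) (at v)" for v
  proof -
    have "0 < 1 + v\<^sup>2" by (simp add: add_pos_nonneg)
    then have "((\<lambda>v. v - (sqrt (1 + v\<^sup>2) - 1) / 9) has_real_derivative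
        1 - inverse (sqrt (1 + v\<^sup>2)) / 2 * (2 * v) / 9) (at v)"
      by (auto intro!: derivative_eq_intros)
    moreover have "1 - inverse s / 2 * (2 * v) / 9 = 1 - v / s / 9" for s :: real
      by (simp add: inverse_eq_divide)
    ultimately show ?thesis
      unfolding q_def trunc_cost_def d_def by (simp only:)
  qed
  \<comment> \<open>\<open>F\<close> is positive everywhere, but \<open>\<nu>\<close> may give no
    mass to a left half-line, so the left endpoint has to satisfy \<open>0 < G a\<close>.\<close>
  have bound: "(\<integral>\<^sup>+x. ennreal (trunc_cost (w x)) * indicator {a<..b} x \<partial>N)
      \<le> ennreal (18 * (H - R b + G b - F b))" if ab: "a \<le> b" and Ga: "0 < G a" for a b
  proof -
    define k where "k x = A (G x, F x) * g x + B (G x, F x) * p x" for x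
    have G_pos: "0 < G x" if "a \<le> x" for x using Ga G_mono[OF that] by simp
    have k: "set_integrable lborel {a<..b} k" "(LINT x:{a<..b}|lborel. k x) = R b - R a"
    proof -
      have openU: "open U"
        unfolding U_def by (intro open_Int open_Collect_less continuous_intros)
      have diff: "G t - G r = (LINT s:{r<..t}|lborel. g s)" "F t - F r = (LINT s:{r<..t}|lborel. p s)"
        if "r \<le> t" for r t
        using that cdf_density_diff[OF g g_nonneg] cdf_density_diff[OF p p_nonneg] prob
        by (auto simp: F_def G_def M_def N_def)
      have ints: "set_integrable lborel {r<..t} g" "set_integrable lborel {r<..t} p" for r t
        using set_integrable_prob_density[OF g g_nonneg] set_integrable_prob_density[OF p p_nonneg] prob
        by (auto simp: M_def N_def)
      have der: "(\<Psi> has_derivative (\<lambda>h. A z * fst h + B z * snd h)) (at z)" if z: "z \<in> U" for z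
      proof -
        have *: "((\<lambda>z::real \<times> real. ln (fst z) - ln (snd z)) has_derivative
            (\<lambda>h. fst h * inverse (fst z) - snd h * inverse (snd z))) (at z)"
          using z by (intro derivative_intros) (auto simp: U_def)
        have "(\<Psi> has_derivative (\<lambda>h. fst z * ((1 - d (ln (fst z) - ln (snd z)) / 9) *
            (fst h * inverse (fst z) - snd h * inverse (snd z)))
            + fst h * q (ln (fst z) - ln (snd z)))) (at z)"
          unfolding \<Psi>_def
          by (intro has_derivative_mult has_derivative_fst has_derivative_ident
              has_derivative_compose[OF *] q_deriv[unfolded has_field_derivative_def])
        moreover have "fst z * (c * (x * inverse (fst z) - y * inverse (snd z))) + x * r
            = (r + c) * x + - (fst z / snd z) * c * y" for c x y r
          using z by (simp add: U_def field_simps)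
        ultimately show ?thesis by (simp only: A_def B_def)
      qed
      have contAB: "continuous_on U A" "continuous_on U B"
        unfolding A_def B_def q_def d_def trunc_cost_def U_def
        by (auto intro!: continuous_intros simp: add_nonneg_eq_0_iff)
      have meas: "(\<lambda>s. A (G s, F s)) \<in> borel_measurable borel" "(\<lambda>s. B (G s, F s)) \<in> borel_measurable borel"
        unfolding A_def B_def q_def d_def by measurable
      have inU: "(G x, F x) \<in> U" if "x \<in> {a..b}" for x
        using that G_pos F_pos by (auto simp: U_def)
      note chain = ac_chain_rule[OF ints diff g_nonneg p_nonneg contG contF openU inU der contAB meas ab]
      show "set_integrable lborel {a<..b} k" "(LINT x:{a<..b}|lborel. k x) = R b - R a"
        using chain by (simp_all add: k_def[abs_def] \<Psi>_def R_def w_def)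
    qed
    have pw: "k x + trunc_cost (w x) * g x / 18 \<le> E x" if "a \<le> x" for x
    proof -
      have w: "exp (w x) = G x / F x" using G_pos[OF that] F_pos[of x] by (simp add: w_def exp_diff)
      have "p x * (g x / p x * q (w x) + (1 - d (w x) / 9) * (g x / p x - exp (w x)) + trunc_cost (w x) * (g x / p x) / 18)
          \<le> p x * (g x / p x * ln (g x / p x))"
        using entropy_pointwise_bound[of "g x / p x" "w x"] g_nonneg p_pos[of x]
        unfolding q_def d_def by (intro mult_left_mono) auto
      also have "p x * (g x / p x * q (w x) + (1 - d (w x) / 9) * (g x / p x - exp (w x)) + trunc_cost (w x) * (g x / p x) / 18)
          = k x + trunc_cost (w x) * g x / 18"
      proof -
        have "p x * (g x / p x * r + c * (g x / p x - h) + t * (g x / p x) / 18)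
            = (r + c) * g x + - h * c * p x + t * g x / 18" for r c h t
          using p_pos[of x] by (simp add: field_simps)
        then show ?thesis unfolding k_def A_def B_def w fst_conv snd_conv w_def[symmetric] .
      qed
      finally show ?thesis using p_pos[of x] by (simp add: E_def)
    qed
    have "(\<integral>\<^sup>+x. ennreal (trunc_cost (w x)) * indicator {a<..b} x \<partial>N)
        = (\<integral>\<^sup>+x. ennreal (18 * (trunc_cost (w x) * g x / 18 * indicator {a<..b} x)) \<partial>lborel)"
      unfolding N_def using g_nonneg
      by (subst nn_integral_density)
        (auto intro!: nn_integral_cong simp: indicator_def trunc_cost_nonneg ennreal_mult'' mult.commute)
    also have "\<dots> \<le> (\<integral>\<^sup>+x. ennreal (18 * (indicator {a<..b} x *\<^sub>R (E x - k x))) \<partial>lborel)"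
    proof (intro nn_integral_mono ennreal_leI mult_left_mono)
      fix x show "trunc_cost (w x) * g x / 18 * indicator {a<..b} x \<le> indicator {a<..b} x *\<^sub>R (E x - k x)"
        using pw[of x] by (cases "x \<in> {a<..b}") auto
    qed simp
    also have "\<dots> = ennreal (18 * (LINT x:{a<..b}|lborel. E x - k x))"
    proof (subst nn_integral_eq_integral)
      have "set_integrable lborel {a<..b} (\<lambda>x. E x - k x)"
        using E_int k(1) by (intro set_integral_diff) auto
      then show "integrable lborel (\<lambda>x. 18 * (indicat_real {a<..b} x *\<^sub>R (E x - k x)))"
        unfolding set_integrable_def by (rule integrable_mult_right)
      show "AE x in lborel. 0 \<le> 18 * (indicat_real {a<..b} x *\<^sub>R (E x - k x))"
      proof (intro AE_I2)
        fix x
        have "0 \<le> trunc_cost (w x) * g x / 18"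
          using trunc_cost_nonneg[of "w x"] g_nonneg[of x] by simp
        then have "0 \<le> E x - k x" if "a < x"
          using pw[of x] that by linarith
        then show "0 \<le> 18 * (indicat_real {a<..b} x *\<^sub>R (E x - k x))" by (auto simp: indicator_def)
      qed
    qed (simp add: set_lebesgue_integral_def)
    also have "\<dots> \<le> ennreal (18 * (H - R b + G b - F b))"
    proof -
      have "H = (LINT x:{..a} \<union> {a<..b} \<union> {b<..}|lborel. E x)"
      proof -
        have "{..a} \<union> {a<..b} \<union> {b<..} = UNIV" using ab by auto
        then show ?thesis by (simp add: H_def set_lebesgue_integral_def)
      qed
      also have "\<dots> = (LINT x:{..a}|lborel. E x) + (LINT x:{a<..b}|lborel. E x) + (LINT x:{b<..}|lborel. E x)"
        using ab by (subst set_integral_Un set_integral_Un; (intro E_int)?; auto)+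
      finally have H: "H = (LINT x:{..a}|lborel. E x) + (LINT x:{a<..b}|lborel. E x) + (LINT x:{b<..}|lborel. E x)" .
      \<comment> \<open>The choice \<open>c = w a\<close> in \<open>E_lower\<close> makes
        \<open>G a\<close> and \<open>exp (w a) * F a\<close> cancel, so the entropy to the left of
        \<open>a\<close> pays for the boundary term at \<open>a\<close>.\<close>
      have "R a \<le> w a * G a"
        using Ga trunc_cost_nonneg[of "w a"] by (simp add: R_def q_def mult.commute)
      also have "\<dots> \<le> (LINT x:{..a}|lborel. E x)"
        using E_lower[of "{..a}" "w a"] Ga F_pos[of a]
        by (simp add: w_def exp_diff flip: cdf_def F_def G_def) (simp add: F_def G_def cdf_def)
      finally have Ra: "R a \<le> (LINT x:{..a}|lborel. E x)" .
      have "{b<..} = UNIV - {..b}" by auto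
      then have "measure N {b<..} = 1 - G b" "measure M {b<..} = 1 - F b"
        using N.prob_compl[of "{..b}"] M.prob_compl[of "{..b}"] by (auto simp: F_def G_def cdf_def)
      then have "F b - G b \<le> (LINT x:{b<..}|lborel. E x)"
        using E_lower[of "{b<..}" 0] by simp
      moreover have "(LINT x:{a<..b}|lborel. E x - k x) = (LINT x:{a<..b}|lborel. E x) - (R b - R a)"
        using E_int k by (simp add: set_integral_diff)
      ultimately show ?thesis using H Ra by (intro ennreal_leI) simp
    qed
    finally show ?thesis .
  qed
  \<comment> \<open>The \<open>+ 2\<close> puts the level strictly between 0 and 1 even for
    \<open>n = 0\<close>, so that \<open>G\<close> attains it; the point of attainment serves as
    left endpoint.\<close>
  define u where "u n x = ennreal (trunc_cost (w x)) * indicator {x. 1 / (real n + 2) < G x \<and> x \<le> real n} x" for n x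
  have u_le: "(\<integral>\<^sup>+x. u n x \<partial>N) \<le> ennreal (18 * (H - R (real n) + G (real n) - F (real n)))" for n
  proof -
    obtain a where a: "G a = 1 / (real n + 2)"
      using N.cdf_attains[of "1 / (real n + 2)"] contG unfolding G_def by (auto simp: field_simps)
    have sub: "x \<in> {a<..real n}" if "1 / (real n + 2) < G x" "x \<le> real n" for x
      using that G_mono[of x a] a by force
    show ?thesis
    proof (cases "a \<le> real n")
      case True
      have "(\<integral>\<^sup>+x. u n x \<partial>N) \<le> (\<integral>\<^sup>+x. ennreal (trunc_cost (w x)) * indicator {a<..real n} x \<partial>N)"
        unfolding u_def
      proof (intro nn_integral_mono)
        fix x show "ennreal (trunc_cost (w x)) * indicator {x. 1 / (real n + 2) < G x \<and> x \<le> real n} x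
            \<le> ennreal (trunc_cost (w x)) * indicator {a<..real n} x"
          using sub[of x] by (cases "1 / (real n + 2) < G x \<and> x \<le> real n") auto
      qed
      also have "\<dots> \<le> ennreal (18 * (H - R (real n) + G (real n) - F (real n)))"
        using True a by (intro bound) auto
      finally show ?thesis .
    next
      case False
      then have "u n x = 0" for x using sub[of x] by (auto simp: u_def indicator_def)
      then show ?thesis by simp
    qed
  qed
  \<comment> \<open>Fatou's lemma applies since almost every point has \<open>G x > 0\<close> and
    hence lies in all but finitely many of the truncation sets.\<close>
  have "(\<integral>\<^sup>+x. ennreal (trunc_cost (w x)) \<partial>N) = (\<integral>\<^sup>+x. liminf (\<lambda>n. u n x) \<partial>N)"
  proof (intro nn_integral_cong_AE)
    have "AE x in N. 0 < cdf N x \<and> cdf N x < 1"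
      by (rule N.AE_cdf_in_unit) (use contG in \<open>simp add: G_def\<close>)
    then show "AE x in N. ennreal (trunc_cost (w x)) = liminf (\<lambda>n. u n x)"
    proof eventually_elim
      case (elim x)
      have "(\<lambda>n. 1 / (real n + 2)) \<longlonglongrightarrow> 0" by real_asymp
      then have "eventually (\<lambda>n. 1 / (real n + 2) < G x) sequentially"
        using elim by (intro order_tendstoD) (auto simp: G_def)
      moreover have "eventually (\<lambda>n. x \<le> real n) sequentially"
        using filterlim_real_sequentially by (simp add: filterlim_at_top)
      ultimately have "eventually (\<lambda>n. u n x = ennreal (trunc_cost (w x))) sequentially"
        by eventually_elim (auto simp: u_def)
      then have "(\<lambda>n. u n x) \<longlonglongrightarrow> ennreal (trunc_cost (w x))"
        by (rule tendsto_eventually)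
      then show ?case by (intro lim_imp_Liminf[symmetric]) auto
    qed
  qed
  also have "\<dots> \<le> liminf (\<lambda>n. \<integral>\<^sup>+x. u n x \<partial>N)"
    unfolding u_def by (intro nn_integral_liminf) measurable
  also have "\<dots> \<le> liminf (\<lambda>n. ennreal (18 * (H - R (real n) + G (real n) - F (real n))))"
    by (intro Liminf_mono always_eventually allI u_le)
  also have "\<dots> = ennreal (18 * H)"
  proof (rule lim_imp_Liminf)
    \<comment> \<open>At the right end both distribution functions tend to 1 and
      \<open>q 0 = 0\<close>, so all boundary terms disappear.\<close>
    have G1: "(\<lambda>n. G (real n)) \<longlonglongrightarrow> 1" and F1: "(\<lambda>n. F (real n)) \<longlonglongrightarrow> 1"
      using N.cdf_lim_infty_prob M.cdf_lim_infty_prob by (auto simp: F_def G_def)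
    then have "(\<lambda>n. R (real n)) \<longlonglongrightarrow> 1 * (ln 1 - ln 1 - (sqrt (1 + (ln 1 - ln 1)\<^sup>2) - 1) / 9)"
      unfolding R_def q_def w_def trunc_cost_def by (intro tendsto_intros) auto
    then have "(\<lambda>n. 18 * (H - R (real n) + G (real n) - F (real n))) \<longlonglongrightarrow> 18 * (H - 0 + 1 - 1)"
      using F1 G1 by (intro tendsto_intros) auto
    then show "(\<lambda>n. ennreal (18 * (H - R (real n) + G (real n) - F (real n)))) \<longlonglongrightarrow> ennreal (18 * H)"
      by (intro tendsto_ennrealI) simp
  qed auto
  finally show ?thesis by (simp add: w_def F_def G_def H_def E_def)
qed

section \<open>From the two one-sided costs to the transport inequality\<close>

lemma trunc_cost_ge:
  assumes t: "0 \<le> t" "t \<le> \<bar>w\<bar>"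
  shows "t\<^sup>2 / (2 + t) \<le> trunc_cost w"
proof -
  have "sqrt (1 + t\<^sup>2) \<le> 1 + t"
    using trunc_cost_le_abs[of t] t by (simp add: trunc_cost_def)
  then have "trunc_cost t * (sqrt (1 + t\<^sup>2) + 1) \<le> trunc_cost t * (2 + t)"
    using trunc_cost_nonneg[of t] by (intro mult_left_mono) auto
  moreover have "trunc_cost t * (sqrt (1 + t\<^sup>2) + 1) = t\<^sup>2"
    by (simp add: trunc_cost_def algebra_simps)
  ultimately have "t\<^sup>2 / (2 + t) \<le> trunc_cost t" using t by (simp add: divide_le_eq)
  also have "\<dots> \<le> trunc_cost w"
    using t power_mono[of t "\<bar>w\<bar>" 2] by (simp add: trunc_cost_def)
  finally show ?thesis .
qed

text \<open>One of \<open>\<bar>a\<bar>\<close>, \<open>\<bar>b\<bar>\<close> is at least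
  \<open>t\<close>, half of the lower bound. For small \<open>d\<close> the cost of \<open>t\<close>
  is quadratic in \<open>t\<close>, which is of order \<open>d\<close>; for large \<open>d\<close>
  it is only linear in \<open>t\<close>, but \<open>t\<close> is then of order
  \<open>d\<^sup>2\<close>. Writing \<open>t\<close> with the factor \<open>e = 1 + d / 4\<close>
  treats both regimes at once.\<close>

lemma sq_le_trunc_costs:
  fixes a b d k :: real
  assumes k: "0 < k" and d: "0 \<le> d" and le: "k * (d + d\<^sup>2 / 4) \<le> \<bar>a\<bar> + \<bar>b\<bar>"
  shows "d\<^sup>2 \<le> (2 + 2 * k) / (k / 2)\<^sup>2 * (trunc_cost a + trunc_cost b)"
proof -
  define \<kappa> where "\<kappa> = k / 2"
  define t where "t = \<kappa> * (d + d\<^sup>2 / 4)"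
  have \<kappa>: "\<kappa> > 0" using k by (simp add: \<kappa>_def)
  have t: "t \<ge> 0" using \<kappa> d by (simp add: t_def)
  have "t \<le> \<bar>a\<bar> \<or> t \<le> \<bar>b\<bar>" using le by (auto simp: t_def \<kappa>_def)
  then have ge: "t\<^sup>2 / (2 + t) \<le> trunc_cost a + trunc_cost b"
    using trunc_cost_ge[OF t, of a] trunc_cost_ge[OF t, of b] trunc_cost_nonneg[of a] trunc_cost_nonneg[of b]
    by linarith
  define e where "e = 1 + d / 4"
  have e: "e \<ge> 1" using d by (simp add: e_def)
  have te: "t = \<kappa> * d * e" by (simp add: t_def e_def algebra_simps power2_eq_square)
  have "\<kappa> * d * e \<le> \<kappa> * (4 * e) * e"
    using \<kappa> d e by (intro mult_right_mono mult_left_mono) (auto simp: e_def)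
  moreover have "1 \<le> e\<^sup>2" using e by (simp add: one_le_power)
  ultimately have "2 + t \<le> (2 + 4 * \<kappa>) * e\<^sup>2"
    by (simp add: te power2_eq_square algebra_simps)
  then have "\<kappa>\<^sup>2 * d\<^sup>2 * (2 + t) \<le> \<kappa>\<^sup>2 * d\<^sup>2 * ((2 + 4 * \<kappa>) * e\<^sup>2)"
    by (intro mult_left_mono) auto
  also have "\<dots> = (2 + 4 * \<kappa>) * t\<^sup>2"
    by (simp add: te power_mult_distrib)
  finally have "\<kappa>\<^sup>2 * d\<^sup>2 * (2 + t) \<le> (2 + 4 * \<kappa>) * t\<^sup>2" .
  then have "d\<^sup>2 \<le> (2 + 4 * \<kappa>) / \<kappa>\<^sup>2 * (t\<^sup>2 / (2 + t))"
  proof -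
    have "(2 + 4 * \<kappa>) / \<kappa>\<^sup>2 * (t\<^sup>2 / (2 + t)) = (2 + 4 * \<kappa>) * t\<^sup>2 / (\<kappa>\<^sup>2 * (2 + t))" by simp
    moreover have "0 < \<kappa>\<^sup>2 * (2 + t)" using t \<kappa> by simp
    ultimately show ?thesis
      using \<open>\<kappa>\<^sup>2 * d\<^sup>2 * (2 + t) \<le> (2 + 4 * \<kappa>) * t\<^sup>2\<close>
      by (simp only: pos_le_divide_eq) (simp add: mult_ac)
  qed
  also have "\<dots> \<le> (2 + 4 * \<kappa>) / \<kappa>\<^sup>2 * (trunc_cost a + trunc_cost b)"
    using ge \<kappa> by (intro mult_left_mono) auto
  finally show ?thesis by (simp add: \<kappa>_def)
qed

lemma density_reflect:
  assumes [measurable]: "g \<in> borel_measurable borel"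
  shows "density lborel (\<lambda>x::real. ennreal (g (- x))) = distr (density lborel (\<lambda>x. ennreal (g x))) borel uminus"
proof -
  have "density lborel (\<lambda>x::real. ennreal (g (- x)))
      = density (distr lborel borel uminus) (\<lambda>x::real. ennreal (g (- x)))"
    by (simp add: lborel_distr_uminus)
  also have "\<dots> = distr (density lborel (\<lambda>x. ennreal (g (- (- x))))) borel uminus"
    by (subst density_distr) auto
  finally show ?thesis by simp
qed

lemma cdf_reflect:
  fixes g :: "real \<Rightarrow> real"
  assumes g: "g \<in> borel_measurable borel" "\<And>x. 0 \<le> g x"
    and p: "prob_space (density lborel (\<lambda>x. ennreal (g x)))"
  shows "cdf (density lborel (\<lambda>x. ennreal (g (- x)))) x = 1 - cdf (density lborel (\<lambda>x. ennreal (g x))) (- x)"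
proof -
  let ?N = "density lborel (\<lambda>x. ennreal (g x))"
  interpret real_distribution ?N by (rule real_distribution_density[OF p])
  have "cdf (density lborel (\<lambda>x. ennreal (g (- x)))) x = measure ?N (uminus -` {..x})"
    by (simp add: density_reflect[OF g(1)] cdf_def measure_distr)
  also have "uminus -` {..x} = {-x} \<union> (UNIV - {.. -x})" by auto
  also have "measure ?N \<dots> = measure ?N {-x} + measure ?N (UNIV - {.. -x})"
    by (intro finite_measure_Union) auto
  also have "measure ?N {-x} = 0"
    using isCont_cdf_density[OF g p, of "-x"] by (simp add: isCont_cdf)
  also have "measure ?N (UNIV - {.. -x}) = 1 - cdf ?N (- x)"
    using prob_compl[of "{.. -x}"] by (simp add: cdf_def)
  finally show ?thesis by simp
qed

lemma entropy_nonneg: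
  fixes p g :: "real \<Rightarrow> real"
  assumes p: "p \<in> borel_measurable borel" "\<And>x. 0 < p x" "prob_space (density lborel (\<lambda>x. ennreal (p x)))"
    and g: "g \<in> borel_measurable borel" "\<And>x. 0 \<le> g x" "prob_space (density lborel (\<lambda>x. ennreal (g x)))"
    and ent: "integrable lborel (\<lambda>x. g x * ln (g x / p x))"
  shows "0 \<le> (LINT x|lborel. g x * ln (g x / p x))"
proof -
  have p_nonneg: "0 \<le> p x" for x using p(2)[of x] by simp
  note ip = integrable_prob_density[OF p(1) p_nonneg p(3)]
  note ig = integrable_prob_density[OF g]
  have "0 = (LINT x|lborel. g x - p x)"
    using ip ig by simp
  also have "\<dots> \<le> (LINT x|lborel. g x * ln (g x / p x))"
    using entropy_ge_affine[of "g _" "p _" 0] p(2) g(2) ip ig ent by (intro integral_mono) auto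
  finally show ?thesis .
qed

text \<open>The monotone map \<open>S\<close> satisfies \<open>F (S y) = G y\<close> almost
  everywhere, so \<open>growth\<close> at \<open>z = S y\<close> bounds the squared displacement by
  the costs of the ratios of \<open>G\<close> to \<open>F\<close> and of \<open>1 - G\<close> to
  \<open>1 - F\<close>. Each cost integrates to at most 18 times the entropy, the second by
  reflection; hence 36.\<close>

lemma satisfies_T2I:
  fixes p :: "real \<Rightarrow> real" and C :: real
  defines "M \<equiv> density lborel (\<lambda>x. ennreal (p x))"
  assumes p [measurable]: "p \<in> borel_measurable borel" and p_pos: "\<And>x. 0 < p x"
    and prob: "prob_space M" and C: "0 < C"
    and growth: "\<And>y z. (y - z)\<^sup>2 \<le> C * (trunc_cost (ln (cdf M z) - ln (cdf M y))
         + trunc_cost (ln (1 - cdf M z) - ln (1 - cdf M y)))"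
  shows "satisfies_T2 M (36 * C)"
  unfolding satisfies_T2_def
proof (intro allI impI, elim conjE)
  fix \<nu> :: "real measure" assume \<nu>: "prob_space \<nu>" "sets \<nu> = sets borel"
  show "enn2ereal (W2sq \<nu> M) \<le> ereal (36 * C) * relent \<nu> M"
  proof (cases "absolutely_continuous M \<nu> \<and> integrable \<nu> (\<lambda>x. ln (enn2real (RN_deriv M \<nu> x)))")
    case False
    then have "relent \<nu> M = \<infinity>" by (auto simp: relent_def)
    then show ?thesis using C by simp
  next
    case True
    then have ac: "absolutely_continuous M \<nu>" by simp
    interpret M: real_distribution M unfolding M_def
      by (rule real_distribution_density) (use prob in \<open>simp add: M_def\<close>)
    interpret \<nu>: real_distribution \<nu>
      using \<nu> by (simp add: real_distribution_def real_distribution_axioms_def)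
    define f where "f x = enn2real (RN_deriv M \<nu> x)" for x
    define g where "g x = f x * p x" for x
    have [measurable]: "f \<in> borel_measurable borel"
      using borel_measurable_RN_deriv[of M \<nu>] unfolding f_def by simp
    have [measurable]: "g \<in> borel_measurable borel" unfolding g_def by measurable
    have f_nonneg: "0 \<le> f x" for x by (simp add: f_def)
    have g_nonneg: "0 \<le> g x" for x using f_nonneg[of x] p_pos[of x] by (simp add: g_def less_imp_le)
    have \<nu>_eq: "\<nu> = density lborel (\<lambda>x. ennreal (g x))"
    proof -
      have "\<nu> = density M (RN_deriv M \<nu>)"
        using ac \<nu>(2) by (intro M.density_RN_deriv[symmetric]) auto
      also have "\<dots> = density M (\<lambda>x. ennreal (f x))"
      proof (intro density_cong)
        have "AE x in M. RN_deriv M \<nu> x \<noteq> \<infinity>"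
          using ac \<nu>(2) \<nu>.sigma_finite_measure_axioms by (intro M.RN_deriv_finite) auto
        then show "AE x in M. RN_deriv M \<nu> x = ennreal (f x)"
          by eventually_elim (simp add: f_def less_top)
      qed auto
      also have "\<dots> = density lborel (\<lambda>x. ennreal (g x))"
        unfolding M_def using f_nonneg p_pos
        by (subst density_density_eq) (auto simp: g_def ennreal_mult less_imp_le mult.commute)
      finally show ?thesis .
    qed
    have gp: "g x / p x = f x" for x using p_pos[of x] by (simp add: g_def)
    define H where "H = (LINT x|lborel. g x * ln (g x / p x))"
    have ent: "integrable lborel (\<lambda>x. g x * ln (g x / p x))" and relent: "relent \<nu> M = ereal H"
    proof -
      have "integrable (density lborel (\<lambda>x. ennreal (g x))) (\<lambda>x. ln (f x))"
        using True by (simp add: f_def flip: \<nu>_eq)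
      then show "integrable lborel (\<lambda>x. g x * ln (g x / p x))"
        using g_nonneg by (simp add: integrable_density gp)
      have "(\<integral>x. ln (f x) \<partial>density lborel (\<lambda>x. ennreal (g x))) = H"
        using g_nonneg by (simp add: integral_density gp H_def)
      then show "relent \<nu> M = ereal H"
        using True by (simp add: relent_def f_def flip: \<nu>_eq)
    qed
    have prob_p: "prob_space (density lborel (\<lambda>x. ennreal (p x)))" using prob by (simp add: M_def)
    have prob_g: "prob_space (density lborel (\<lambda>x. ennreal (g x)))" using \<nu>(1) by (simp flip: \<nu>_eq)
    have p_nonneg: "0 \<le> p x" for x using p_pos[of x] by simp
    have H: "0 \<le> H"
      unfolding H_def using p_pos prob_p g_nonneg prob_g ent by (intro entropy_nonneg) auto
    define F where "F = cdf M"
    define G where "G = cdf \<nu>"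
    have contF: "isCont F x" for x
      using isCont_cdf_density[OF p p_nonneg prob_p] by (simp add: F_def M_def)
    have contG: "isCont G x" for x
      using isCont_cdf_density[of g, OF _ g_nonneg prob_g] by (simp add: G_def flip: \<nu>_eq)
    have F_strict: "F x < F y" if "x < y" for x y
      using cdf_density_strict_mono[OF p p_pos prob_p that] by (simp add: F_def M_def)
    have [measurable]: "F \<in> borel_measurable borel" "G \<in> borel_measurable borel"
      unfolding F_def G_def by measurable
    have [measurable]: "trunc_cost \<in> borel_measurable borel"
      unfolding trunc_cost_def by measurable

    \<comment> \<open>The quantile function of \<open>M\<close>; the chosen point is unique because
      \<open>F\<close> is strictly increasing. The default 0 is reached by \<open>S\<close> only
      where \<open>G y\<close> is 0 or 1, a null set of \<open>\<nu>\<close>.\<close>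
    define Q where "Q u = (if 0 < u \<and> u < 1 then SOME z. F z = u else 0)" for u
    have FQ: "F (Q u) = u" if "0 < u" "u < 1" for u
    proof -
      have "\<exists>z. F z = u" using M.cdf_attains[of u] contF that unfolding F_def by metis
      then have "F (SOME z. F z = u) = u" by (rule someI_ex)
      then show ?thesis using that by (simp add: Q_def)
    qed
    \<comment> \<open>This Galois connection gives both the measurability of \<open>Q\<close> and
      the law of \<open>S\<close>.\<close>
    have Q_le: "Q u \<le> z \<longleftrightarrow> u \<le> F z" if "0 < u" "u < 1" for u z
      using FQ[OF that] F_strict[of "Q u" z] F_strict[of z "Q u"] by (cases "Q u" z rule: linorder_cases) auto
    have [measurable]: "Q \<in> borel_measurable borel"
    proof (rule borel_measurable_iff_le[THEN iffD2, rule_format])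
      fix z
      have "{u. Q u \<le> z} = ({0<..<1} \<inter> {..F z}) \<union> (if 0 \<le> z then - {0<..<1} else {})"
        using Q_le by (auto simp: Q_def)
      then show "{u \<in> space borel. Q u \<le> z} \<in> sets borel" by simp
    qed
    define S where "S y = Q (G y)" for y
    have [measurable]: "S \<in> borel_measurable borel" unfolding S_def by measurable
    have AE01: "AE y in \<nu>. 0 < G y \<and> G y < 1"
      using \<nu>.AE_cdf_in_unit contG by (simp add: G_def)
    \<comment> \<open>Up to a null set \<open>S y \<le> z\<close> means
      \<open>G y \<le> F z\<close>, and \<open>G\<close> is uniformly distributed under
      \<open>\<nu>\<close>.\<close>
    have distr_S: "distr \<nu> borel S = M"
    proof (rule cdf_unique)
      show "cdf (distr \<nu> borel S) = cdf M"
      proof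
        fix z
        have "cdf (distr \<nu> borel S) z = measure \<nu> {y. S y \<le> z}"
          by (simp add: cdf_def measure_distr vimage_def)
        also have "\<dots> = measure \<nu> {y. G y \<le> F z}"
        proof (rule measure_eq_AE)
          show "AE y in \<nu>. y \<in> {y. S y \<le> z} \<longleftrightarrow> y \<in> {y. G y \<le> F z}"
            using AE01 by eventually_elim (simp add: S_def Q_le)
        qed measurable
        also have "\<dots> = F z"
          unfolding G_def using contG M.cdf_nonneg M.cdf_bounded_prob
          by (intro \<nu>.measure_cdf_le) (auto simp: G_def F_def)
        finally show "cdf (distr \<nu> borel S) z = cdf M z" by (simp add: F_def)
      qed
    qed (auto intro: M.real_distribution_axioms)
    define \<pi> where "\<pi> = distr \<nu> borel (\<lambda>y. (y, S y))"
    have [measurable]: "(\<lambda>y. (y, S y)) \<in> borel_measurable \<nu>" by measurable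
    have [measurable]: "fst \<in> borel_measurable (borel :: (real \<times> real) measure)"
      "snd \<in> borel_measurable (borel :: (real \<times> real) measure)"
      by (auto intro!: borel_measurable_continuous_onI continuous_intros)
    have "coupling \<nu> M \<pi>"
    proof -
      have "distr \<nu> borel (\<lambda>y. y) = \<nu>" by (rule distr_id2) (use \<nu>(2) in auto)
      then show ?thesis
        unfolding coupling_def \<pi>_def
        by (auto intro!: \<nu>.prob_space_distr simp: distr_distr comp_def distr_S)
    qed
    then have "W2sq \<nu> M \<le> (\<integral>\<^sup>+ z. ennreal ((fst z - snd z)\<^sup>2) \<partial>\<pi>)"
      unfolding W2sq_def by (intro INF_lower) auto
    also have "\<dots> = (\<integral>\<^sup>+ y. ennreal ((y - S y)\<^sup>2) \<partial>\<nu>)"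
      unfolding \<pi>_def by (subst nn_integral_distr) auto
    also have "\<dots> \<le> (\<integral>\<^sup>+ y. ennreal C * (ennreal (trunc_cost (ln (G y) - ln (F y)))
         + ennreal (trunc_cost (ln (1 - G y) - ln (1 - F y)))) \<partial>\<nu>)"
    proof (intro nn_integral_mono_AE)
      show "AE y in \<nu>. ennreal ((y - S y)\<^sup>2) \<le> ennreal C * (ennreal (trunc_cost (ln (G y) - ln (F y)))
         + ennreal (trunc_cost (ln (1 - G y) - ln (1 - F y))))"
        using AE01
      proof eventually_elim
        case (elim y)
        then have "F (S y) = G y" by (simp add: S_def FQ)
        then have "(y - S y)\<^sup>2 \<le> C * (trunc_cost (ln (G y) - ln (F y)) + trunc_cost (ln (1 - G y) - ln (1 - F y)))"
          using growth[of y "S y"] by (simp flip: F_def)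
        then show ?case
          using C trunc_cost_nonneg by (simp add: ennreal_leI flip: ennreal_plus ennreal_mult)
      qed
    qed
    also have "\<dots> = ennreal C * ((\<integral>\<^sup>+ y. ennreal (trunc_cost (ln (G y) - ln (F y))) \<partial>\<nu>)
         + (\<integral>\<^sup>+ y. ennreal (trunc_cost (ln (1 - G y) - ln (1 - F y))) \<partial>\<nu>))"
      by (simp add: nn_integral_cmult nn_integral_add)
    also have "\<dots> \<le> ennreal C * (ennreal (18 * H) + ennreal (18 * H))"
    proof (intro mult_left_mono add_mono)
      show "(\<integral>\<^sup>+ y. ennreal (trunc_cost (ln (G y) - ln (F y))) \<partial>\<nu>) \<le> ennreal (18 * H)"
        using cdf_ratio_cost_le_entropy[of p g] p_pos g_nonneg prob_p prob_g ent
        by (simp add: F_def G_def H_def M_def flip: \<nu>_eq)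
      \<comment> \<open>Under \<open>x \<mapsto> - x\<close> the upper tails \<open>1 - G\<close>
        and \<open>1 - F\<close> become distribution functions, and the entropy is
        unchanged.\<close>
      define p' where "p' x = p (- x)" for x
      define g' where "g' x = g (- x)" for x
      have [measurable]: "p' \<in> borel_measurable borel" "g' \<in> borel_measurable borel"
        unfolding p'_def g'_def by measurable
      have N': "density lborel (\<lambda>x. ennreal (g' x)) = distr \<nu> borel uminus"
        unfolding g'_def by (simp add: density_reflect flip: \<nu>_eq)
      have M': "density lborel (\<lambda>x. ennreal (p' x)) = distr M borel uminus"
        unfolding p'_def M_def by (simp add: density_reflect)
      have cdfs: "cdf (density lborel (\<lambda>x. ennreal (g' x))) x = 1 - G (- x)"
        "cdf (density lborel (\<lambda>x. ennreal (p' x))) x = 1 - F (- x)" for x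
        using cdf_reflect[of g, OF _ g_nonneg prob_g] cdf_reflect[of p, OF p p_nonneg prob_p]
        by (simp_all add: g'_def p'_def F_def G_def M_def flip: \<nu>_eq)
      have ent': "integrable lborel (\<lambda>x. g' x * ln (g' x / p' x))"
        using lborel_integrable_real_affine[OF ent, of "-1" 0] by (simp add: g'_def p'_def)
      have H': "(LINT x|lborel. g' x * ln (g' x / p' x)) = H"
        unfolding H_def g'_def p'_def
        by (subst (2) lborel_integral_real_affine[where c = "-1" and t = 0]) auto
      have "(\<integral>\<^sup>+ y. ennreal (trunc_cost (ln (1 - G y) - ln (1 - F y))) \<partial>\<nu>)
          = (\<integral>\<^sup>+ x. ennreal (trunc_cost (ln (1 - G (- x)) - ln (1 - F (- x)))) \<partial>density lborel (\<lambda>x. ennreal (g' x)))"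
        unfolding N' by (subst nn_integral_distr) auto
      also have "\<dots> \<le> ennreal (18 * H)"
        using cdf_ratio_cost_le_entropy[of p' g'] p_pos g_nonneg ent'
          M.prob_space_distr[of uminus borel] \<nu>.prob_space_distr[of uminus borel]
        unfolding cdfs H' by (simp add: M' N' flip: p'_def g'_def) (simp add: p'_def g'_def)
      finally show "(\<integral>\<^sup>+ y. ennreal (trunc_cost (ln (1 - G y) - ln (1 - F y))) \<partial>\<nu>) \<le> ennreal (18 * H)" .
    qed auto
    also have "\<dots> = ennreal (36 * C * H)"
      using H C by (simp flip: ennreal_plus ennreal_mult)
    finally have "enn2ereal (W2sq \<nu> M) \<le> enn2ereal (ennreal (36 * C * H))"
      by (simp add: less_eq_ennreal.rep_eq)
    then show ?thesis using H C by (simp add: relent enn2ereal_ennreal)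
  qed
qed

section \<open>The measure \<open>\<mu>\<close>\<close>

text \<open>The derivative of the potential on the positive half-line, grouped so that the leading
  term is visibly nonnegative and has double zeros at the points
  \<open>n * pi - pi / 4\<close>.\<close>

definition V_deriv :: "real \<Rightarrow> real \<Rightarrow> real" where
  "V_deriv \<beta> x = 3 * x\<^sup>2 * (1 + sin (2 * x)) + 6 * x * (sin x)\<^sup>2 + \<beta> * x powr (\<beta> - 1)"

lemma V_even: "V \<beta> (- x) = V \<beta> x"
  by (simp add: V_def)

lemma V_continuous: "continuous_on UNIV (V \<beta>)" if "0 < \<beta>"
  unfolding V_def[abs_def] using that
  by (intro continuous_on_add continuous_on_powr') (auto intro!: continuous_intros)

lemma V_measurable [measurable]: "V \<beta> \<in> borel_measurable borel"
  unfolding V_def[abs_def] by measurable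

lemma V_has_derivative: "(V \<beta> has_real_derivative V_deriv \<beta> x) (at x)" if "0 < x"
proof -
  have "((\<lambda>x. x^3 + 3 * x\<^sup>2 * (sin x)\<^sup>2 + x powr \<beta>) has_real_derivative V_deriv \<beta> x) (at x)"
    unfolding V_deriv_def sin_double using that
    by (auto intro!: derivative_eq_intros simp: algebra_simps power2_eq_square)
  then show ?thesis
    by (rule has_field_derivative_transform_within_open[of _ _ _ "{0<..}"])
      (use that in \<open>auto simp: V_def\<close>)
qed

lemma V_deriv_ge: "\<beta> * x powr (\<beta> - 1) \<le> V_deriv \<beta> x" if "0 \<le> x"
proof -
  have "0 \<le> 1 + sin (2 * x)" using sin_ge_minus_one[of "2 * x"] by linarith
  then have "0 \<le> 3 * x\<^sup>2 * (1 + sin (2 * x)) + 6 * x * (sin x)\<^sup>2" using that by simp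
  then show ?thesis by (simp add: V_deriv_def)
qed

lemma V_mono: "V \<beta> x \<le> V \<beta> y" if "0 < \<beta>" "0 \<le> x" "x \<le> y"
proof (rule DERIV_nonneg_imp_increasing_open[OF \<open>x \<le> y\<close>])
  fix z assume z: "x < z" "z < y"
  have "0 \<le> \<beta> * z powr (\<beta> - 1)" using that by simp
  also have "\<dots> \<le> V_deriv \<beta> z" using z that by (intro V_deriv_ge) auto
  finally show "\<exists>d. (V \<beta> has_real_derivative d) (at z) \<and> 0 \<le> d"
    using V_has_derivative[of z \<beta>] z that by auto
next
  show "continuous_on {x..y} (V \<beta>)"
    using V_continuous[OF that(1)] continuous_on_subset by blast
qed

lemma V_nonneg: "0 \<le> V \<beta> x"
  by (simp add: V_def)

lemma V_ge_cube: "\<bar>x\<bar> ^ 3 \<le> V \<beta> x"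
  by (simp add: V_def)

text \<open>As \<open>3 * t\<^sup>2 \<ge> 1\<close> on the range of integration, the integrand is
  dominated by the derivative of \<open>- exp (- (t ^ 3))\<close>.\<close>

lemma nn_integral_exp_neg_cube_le:
  fixes x :: real
  assumes "1 \<le> x"
  shows "(\<integral>\<^sup>+t. ennreal (exp (- (t ^ 3))) * indicator {x..} t \<partial>lborel) \<le> ennreal (exp (- (x ^ 3)))"
proof -
  have "(\<integral>\<^sup>+t. ennreal (exp (- (t ^ 3))) * indicator {x..} t \<partial>lborel)
      \<le> (\<integral>\<^sup>+t. ennreal (3 * t\<^sup>2 * exp (- (t ^ 3))) * indicator {x..} t \<partial>lborel)"
  proof (intro nn_integral_mono)
    fix t :: real
    have "1 * exp (- (t ^ 3)) \<le> 3 * t\<^sup>2 * exp (- (t ^ 3))" if "x \<le> t"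
      proof (rule mult_right_mono)
      have "1 \<le> t\<^sup>2" using that assms by (intro one_le_power) linarith
      then show "1 \<le> 3 * t\<^sup>2" by simp
    qed simp
    then show "ennreal (exp (- (t ^ 3))) * indicator {x..} t
        \<le> ennreal (3 * t\<^sup>2 * exp (- (t ^ 3))) * indicator {x..} t"
      by (auto simp: indicator_def intro!: ennreal_leI)
  qed
  also have "\<dots> = ennreal (0 - (- exp (- (x ^ 3))))"
  proof (rule nn_integral_FTC_atLeast)
    show "((\<lambda>t::real. - exp (- (t ^ 3))) \<longlongrightarrow> 0) at_top" by real_asymp
  qed (auto intro!: derivative_eq_intros)
  finally show ?thesis by simp
qed

lemma integrable_exp_neg_V: "integrable lborel (\<lambda>x. exp (- V \<beta> x))"
proof (rule integrableI_nonneg)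
  have half: "(\<integral>\<^sup>+x. ennreal (exp (- V \<beta> x)) * indicator {0..} x \<partial>lborel) < \<infinity>"
  proof -
    have "(\<integral>\<^sup>+x. ennreal (exp (- V \<beta> x)) * indicator {0..} x \<partial>lborel)
        \<le> (\<integral>\<^sup>+x. indicator {0..1} x + ennreal (exp (- (x ^ 3))) * indicator {1..} x \<partial>lborel)"
    proof (intro nn_integral_mono)
      fix x :: real
      have "exp (- V \<beta> x) \<le> 1" "0 \<le> x \<Longrightarrow> exp (- V \<beta> x) \<le> exp (- (x ^ 3))"
        using V_nonneg[of \<beta> x] V_ge_cube[of x \<beta>] by auto
      then show "ennreal (exp (- V \<beta> x)) * indicator {0..} x
          \<le> indicator {0..1} x + ennreal (exp (- (x ^ 3))) * indicator {1..} x"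
        by (cases "x \<le> 1") (auto simp: indicator_def ennreal_le_1 add_increasing2 intro!: ennreal_leI)
    qed
    also have "\<dots> \<le> 1 + ennreal (exp (- (1 ^ 3)))"
      using nn_integral_exp_neg_cube_le[of 1] by (subst nn_integral_add) (auto intro!: add_mono)
    also have "\<dots> < \<infinity>" by simp
    finally show ?thesis .
  qed
  have refl: "(\<integral>\<^sup>+x. ennreal (exp (- V \<beta> x)) * indicator {..0} x \<partial>lborel)
      = (\<integral>\<^sup>+x. ennreal (exp (- V \<beta> x)) * indicator {0..} x \<partial>lborel)"
    by (subst nn_integral_real_affine[where c = "-1" and t = 0])
      (auto intro!: nn_integral_cong simp: V_even indicator_def)
  have "(\<integral>\<^sup>+x. ennreal (exp (- V \<beta> x)) \<partial>lborel)
      \<le> (\<integral>\<^sup>+x. ennreal (exp (- V \<beta> x)) * indicator {..0} x + ennreal (exp (- V \<beta> x)) * indicator {0..} x \<partial>lborel)"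
    by (intro nn_integral_mono) (auto simp: indicator_def)
  also have "\<dots> < \<infinity>"
    using half refl by (subst nn_integral_add) auto
  finally show "(\<integral>\<^sup>+x. ennreal (exp (- V \<beta> x)) \<partial>lborel) < \<infinity>" .
qed auto

lemma Z_pos: "0 < Z \<beta>"
proof -
  have "Z \<beta> \<noteq> 0"
  proof
    assume "Z \<beta> = 0"
    then have "AE x in lborel. exp (- V \<beta> x) = 0"
      using integral_nonneg_eq_0_iff_AE[OF integrable_exp_neg_V] by (simp add: Z_def)
    then have "emeasure lborel (UNIV :: real set) = 0"
      by (subst (asm) AE_iff_measurable[of UNIV]) auto
    then show False by simp
  qed
  moreover have "0 \<le> Z \<beta>" unfolding Z_def by (intro Bochner_Integration.integral_nonneg) auto
  ultimately show ?thesis by simp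
qed

definition mu_density :: "real \<Rightarrow> real \<Rightarrow> real" where
  "mu_density \<beta> x = exp (- V \<beta> x) / Z \<beta>"

lemma mu_eq: "mu \<beta> = density lborel (\<lambda>x. ennreal (mu_density \<beta> x))"
  by (simp add: mu_def mu_density_def)

lemma mu_density_measurable [measurable]: "mu_density \<beta> \<in> borel_measurable borel"
  unfolding mu_density_def[abs_def] by measurable

lemma mu_density_pos: "0 < mu_density \<beta> x"
  using Z_pos by (simp add: mu_density_def)

lemma mu_density_even: "mu_density \<beta> (- x) = mu_density \<beta> x"
  by (simp add: mu_density_def V_even)

lemma isCont_mu_density: "0 < \<beta> \<Longrightarrow> isCont (mu_density \<beta>) x"
  unfolding mu_density_def[abs_def] using V_continuous[of \<beta>] Z_pos[of \<beta>]
  by (auto intro!: continuous_intros simp: continuous_on_eq_continuous_at)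

lemma mu_density_antimono: "0 < \<beta> \<Longrightarrow> 0 \<le> x \<Longrightarrow> x \<le> y \<Longrightarrow> mu_density \<beta> y \<le> mu_density \<beta> x"
  using V_mono[of \<beta> x y] Z_pos[of \<beta>] by (simp add: mu_density_def divide_right_mono)

lemma prob_space_mu: "prob_space (mu \<beta>)"
proof
  have "(\<integral>\<^sup>+x. ennreal (mu_density \<beta> x) \<partial>lborel) = ennreal (LINT x|lborel. mu_density \<beta> x)"
    using integrable_exp_neg_V[of \<beta>] mu_density_pos[of \<beta>]
    by (intro nn_integral_eq_integral) (auto simp: mu_density_def less_imp_le)
  also have "(LINT x|lborel. mu_density \<beta> x) = 1"
    using Z_pos[of \<beta>] by (simp add: mu_density_def Z_def)
  finally show "emeasure (mu \<beta>) (space (mu \<beta>)) = 1"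
    by (simp add: mu_eq emeasure_density)
qed

lemma cdf_mu_has_derivative:
  assumes "0 < \<beta>"
  shows "(cdf (mu \<beta>) has_real_derivative mu_density \<beta> x) (at x)"
proof -
  let ?p = "mu_density \<beta>"
  have pos: "0 \<le> ?p y" for y using mu_density_pos[of \<beta> y] by simp
  have prob: "prob_space (density lborel (\<lambda>x. ennreal (?p x)))" using prob_space_mu[of \<beta>] by (simp add: mu_eq)
  have "continuous_on {x - 1..x + 1} ?p"
    using isCont_mu_density[OF assms] by (simp add: continuous_at_imp_continuous_on)
  then have "((\<lambda>u. LBINT y=x-1..u. ?p y) has_vector_derivative ?p x) (at x within {x - 1..x + 1})"
    by (intro interval_integral_FTC2) auto
  then have "((\<lambda>u. LBINT y=x-1..u. ?p y) has_real_derivative ?p x) (at x)"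
    by (simp add: at_within_Icc_at has_real_derivative_iff_has_vector_derivative)
  then have "((\<lambda>u. cdf (mu \<beta>) (x - 1) + (LBINT y=x-1..u. ?p y)) has_real_derivative ?p x) (at x)"
    by (auto intro!: derivative_eq_intros)
  then show ?thesis
  proof (rule has_field_derivative_transform_within_open[of _ _ _ "{x - 1<..}"])
    fix u assume "u \<in> {x - 1<..}"
    then show "cdf (mu \<beta>) (x - 1) + (LBINT y=x-1..u. ?p y) = cdf (mu \<beta>) u"
      using cdf_density_diff[OF _ pos prob, of "x - 1" u]
      by (simp add: mu_eq interval_integral_Ioc)
  qed auto
qed

lemma cdf_mu_in_unit: "0 < cdf (mu \<beta>) x" "cdf (mu \<beta>) x < 1"
  using cdf_density_in_unit[of "mu_density \<beta>"] mu_density_pos prob_space_mu[of \<beta>] by (simp_all add: mu_eq)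

lemma cdf_mu_mono: "x \<le> y \<Longrightarrow> cdf (mu \<beta>) x \<le> cdf (mu \<beta>) y"
proof -
  interpret real_distribution "mu \<beta>"
    using real_distribution_density prob_space_mu[of \<beta>] by (simp add: mu_eq)
  show "x \<le> y \<Longrightarrow> cdf (mu \<beta>) x \<le> cdf (mu \<beta>) y" by (rule cdf_nondecreasing)
qed

lemma cdf_mu_uminus: "cdf (mu \<beta>) (- x) = 1 - cdf (mu \<beta>) x"
  using cdf_reflect[of "mu_density \<beta>" "-x"] prob_space_mu[of \<beta>] mu_density_pos[of \<beta>]
  by (simp add: mu_eq mu_density_even less_imp_le)

lemma emeasure_mu: "A \<in> sets borel \<Longrightarrow> emeasure (mu \<beta>) A = (\<integral>\<^sup>+x. ennreal (mu_density \<beta> x) * indicator A x \<partial>lborel)"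
  by (simp add: mu_eq emeasure_density)

section \<open>Tail bounds and growth of the logit\<close>

text \<open>For \<open>t \<ge> x\<close> one has \<open>1 + x \<le> V_deriv \<beta> t\<close>, and
  the integral of \<open>V_deriv \<beta> t * mu_density \<beta> t\<close> over
  \<open>t \<ge> x\<close> is exactly \<open>mu_density \<beta> x\<close>.\<close>

lemma mu_tail_le:
  assumes \<beta>: "2 < \<beta>" and x: "1 \<le> x"
  shows "(1 + x) * (1 - cdf (mu \<beta>) x) \<le> mu_density \<beta> x"
proof -
  interpret real_distribution "mu \<beta>"
    using real_distribution_density prob_space_mu[of \<beta>] by (simp add: mu_eq)
  have "{x<..} = UNIV - {..x}" by auto
  then have tail: "measure (mu \<beta>) {x<..} = 1 - cdf (mu \<beta>) x"
    using prob_compl[of "{..x}"] by (simp add: cdf_def)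
  \<comment> \<open>Comes from the power term: for \<open>\<beta> > 2\<close> and
    \<open>t \<ge> 1\<close> it is at least \<open>2 * t\<close>.\<close>
  have V_deriv_ge_affine: "1 + t \<le> V_deriv \<beta> t" if "1 \<le> t" for t
  proof -
    have "1 + t \<le> 2 * t" using that by simp
    also have "\<dots> \<le> \<beta> * t powr (\<beta> - 1)"
      using \<beta> that powr_mono[of 1 "\<beta> - 1" t] by (intro mult_mono) auto
    also have "\<dots> \<le> V_deriv \<beta> t" using that by (intro V_deriv_ge) auto
    finally show ?thesis .
  qed
  have "ennreal ((1 + x) * (1 - cdf (mu \<beta>) x)) = ennreal (1 + x) * emeasure (mu \<beta>) {x<..}"
    using x by (simp add: emeasure_eq_measure tail ennreal_mult cdf_mu_in_unit less_imp_le)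
  also have "\<dots> = (\<integral>\<^sup>+t. ennreal (1 + x) * (ennreal (mu_density \<beta> t) * indicator {x<..} t) \<partial>lborel)"
    by (simp add: emeasure_mu nn_integral_cmult)
  also have "\<dots> \<le> (\<integral>\<^sup>+t. ennreal (V_deriv \<beta> t * mu_density \<beta> t) * indicator {x..} t \<partial>lborel)"
  proof (intro nn_integral_mono)
    fix t
    show "ennreal (1 + x) * (ennreal (mu_density \<beta> t) * indicator {x<..} t)
        \<le> ennreal (V_deriv \<beta> t * mu_density \<beta> t) * indicator {x..} t"
    proof (cases "x < t")
      case True
      then have "(1 + x) * mu_density \<beta> t \<le> V_deriv \<beta> t * mu_density \<beta> t"
        using V_deriv_ge_affine[of t] x mu_density_pos[of \<beta> t] by (intro mult_right_mono) auto
      then show ?thesis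
        using True x mu_density_pos[of \<beta> t] by (simp add: ennreal_leI del: ennreal_plus flip: ennreal_mult)
    qed auto
  qed
  also have "\<dots> = ennreal (0 - (- mu_density \<beta> x))"
  proof (rule nn_integral_FTC_atLeast)
    show "(\<lambda>t. V_deriv \<beta> t * mu_density \<beta> t) \<in> borel_measurable borel"
      unfolding V_deriv_def by measurable
    show "((\<lambda>t. - mu_density \<beta> t) has_real_derivative V_deriv \<beta> t * mu_density \<beta> t) (at t)" if "x \<le> t" for t
      unfolding mu_density_def[abs_def] using that x Z_pos[of \<beta>]
      by (auto intro!: derivative_eq_intros V_has_derivative simp: mu_density_def)
    show "0 \<le> V_deriv \<beta> t * mu_density \<beta> t" if "x \<le> t" for t
      using V_deriv_ge_affine[of t] that x mu_density_pos[of \<beta> t] by simp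
    have "((\<lambda>t::real. exp (- (t ^ 3))) \<longlongrightarrow> 0) at_top" by real_asymp
    then have "((\<lambda>t. exp (- (t ^ 3)) / Z \<beta>) \<longlongrightarrow> 0) at_top"
      by (rule tendsto_divide_zero)
    then have "((\<lambda>t. mu_density \<beta> t) \<longlongrightarrow> 0) at_top"
    proof (rule tendsto_sandwich[rotated 2, OF tendsto_const])
      show "\<forall>\<^sub>F t in at_top. mu_density \<beta> t \<le> exp (- (t ^ 3)) / Z \<beta>"
        using eventually_ge_at_top[of 0]
      proof eventually_elim
        case (elim t)
        then show ?case using V_ge_cube[of t \<beta>] Z_pos[of \<beta>] by (simp add: mu_density_def divide_right_mono)
      qed
    qed (use mu_density_pos[of \<beta>] in \<open>auto simp: less_imp_le\<close>)
    then show "((\<lambda>t. - mu_density \<beta> t) \<longlongrightarrow> 0) at_top"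
      by (intro tendsto_eq_intros) auto
  qed
  finally show ?thesis
    using mu_density_pos[of \<beta> x] by (simp add: ennreal_le_iff less_imp_le)
qed

text \<open>Beyond 1 the tail bound gives the constant 1. On the unit interval the density is at
  least its value at 1 while \<open>1 + x\<close> times the tail is at most 2, which explains the
  second entry of the minimum.\<close>

lemma mu_hazard_ge:
  assumes \<beta>: "2 < \<beta>"
  obtains k where "0 < k" "\<And>x. 0 \<le> x \<Longrightarrow> k * (1 + x) * (1 - cdf (mu \<beta>) x) \<le> mu_density \<beta> x"
proof
  define k where "k = min 1 (mu_density \<beta> 1 / 2)"
  show k: "0 < k" using mu_density_pos[of \<beta> 1] by (simp add: k_def)
  fix x :: real assume x: "0 \<le> x"
  have F: "0 \<le> 1 - cdf (mu \<beta>) x" "1 - cdf (mu \<beta>) x \<le> 1"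
    using cdf_mu_in_unit[of \<beta> x] by auto
  show "k * (1 + x) * (1 - cdf (mu \<beta>) x) \<le> mu_density \<beta> x"
  proof (cases "x \<le> 1")
    case True
    have "k * (1 + x) * (1 - cdf (mu \<beta>) x) \<le> (mu_density \<beta> 1 / 2) * 2 * 1"
      using True x F k mu_density_pos[of \<beta> 1] by (intro mult_mono) (auto simp: k_def)
    also have "\<dots> \<le> mu_density \<beta> x" using mu_density_antimono[of \<beta> x 1] \<beta> x True by simp
    finally show ?thesis .
  next
    case False
    have "k * ((1 + x) * (1 - cdf (mu \<beta>) x)) \<le> 1 * ((1 + x) * (1 - cdf (mu \<beta>) x))"
      using x F by (intro mult_right_mono) (auto simp: k_def)
    also have "\<dots> \<le> mu_density \<beta> x" using mu_tail_le[OF \<beta>, of x] False by simp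
    finally show ?thesis by (simp add: mult.assoc)
  qed
qed

text \<open>The derivative of \<open>- ln (1 - cdf)\<close> is the hazard rate, at least
  \<open>k * (1 + x)\<close> on the positive half-line, and \<open>ln cdf\<close> only adds to the
  increase. Evenness of \<open>V\<close> makes \<open>L\<close> odd, which carries the bound to the
  negative half-line.\<close>

lemma logit_mu_growth:
  assumes \<beta>: "2 < \<beta>"
  defines "L \<equiv> \<lambda>x. ln (cdf (mu \<beta>) x) - ln (1 - cdf (mu \<beta>) x)"
  obtains k where "0 < k" "\<And>y z. z \<le> y \<Longrightarrow> k * ((y - z) + (y - z)\<^sup>2 / 4) \<le> L y - L z"
proof -
  obtain k where k: "0 < k" "\<And>x. 0 \<le> x \<Longrightarrow> k * (1 + x) * (1 - cdf (mu \<beta>) x) \<le> mu_density \<beta> x"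
    using mu_hazard_ge[OF \<beta>] by metis
  have pos: "k * ((y - z) + (y\<^sup>2 - z\<^sup>2) / 2) \<le> L y - L z" if "0 \<le> z" "z \<le> y" for y z
  proof -
    define \<Theta> where "\<Theta> x = - ln (1 - cdf (mu \<beta>) x) - k * (x + x\<^sup>2 / 2)" for x
    have "\<Theta> z \<le> \<Theta> y"
    proof (rule DERIV_nonneg_imp_nondecreasing[OF \<open>z \<le> y\<close>])
      fix x assume x: "z \<le> x" "x \<le> y"
      have F: "0 < 1 - cdf (mu \<beta>) x" using cdf_mu_in_unit[of \<beta> x] by simp
      have "(\<Theta> has_real_derivative mu_density \<beta> x / (1 - cdf (mu \<beta>) x) - k * (1 + x)) (at x)"
        unfolding \<Theta>_def using F \<beta>
        by (auto intro!: derivative_eq_intros cdf_mu_has_derivative simp: field_simps)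
      moreover have "0 \<le> mu_density \<beta> x / (1 - cdf (mu \<beta>) x) - k * (1 + x)"
        using k(2)[of x] x that F by (simp add: pos_le_divide_eq)
      ultimately show "\<exists>d. (\<Theta> has_real_derivative d) (at x) \<and> 0 \<le> d" by blast
    qed
    moreover have "ln (cdf (mu \<beta>) z) \<le> ln (cdf (mu \<beta>) y)"
      using cdf_mu_mono[OF that(2)] cdf_mu_in_unit by simp
    ultimately show ?thesis by (simp add: \<Theta>_def L_def field_simps)
  qed
  have odd: "L (- x) = - L x" for x by (simp add: L_def cdf_mu_uminus)
  have "k * ((y - z) + (y - z)\<^sup>2 / 4) \<le> L y - L z" if "z \<le> y" for y z
  proof -
    consider "0 \<le> z" | "y \<le> 0" | "z \<le> 0" "0 \<le> y" by linarith
    then show ?thesis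
    proof cases
      case 1
      have "0 \<le> z * (y - z)" using 1 that by simp
      then have "(y - z)\<^sup>2 / 4 \<le> (y\<^sup>2 - z\<^sup>2) / 2"
        using zero_le_power2[of "y - z"] by (simp add: power2_eq_square field_simps)
      then have "k * ((y - z) + (y - z)\<^sup>2 / 4) \<le> k * ((y - z) + (y\<^sup>2 - z\<^sup>2) / 2)"
        using k(1) by (intro mult_left_mono) auto
      then show ?thesis using pos[OF 1 that] by linarith
    next
      case 2
      have "0 \<le> - y * (y - z)" using 2 that by (simp add: mult_nonpos_nonneg)
      then have "(y - z)\<^sup>2 / 4 \<le> ((-z)\<^sup>2 - (-y)\<^sup>2) / 2"
        using zero_le_power2[of "y - z"] by (simp add: power2_eq_square field_simps)
      then have "k * ((y - z) + (y - z)\<^sup>2 / 4) \<le> k * ((- z - - y) + ((-z)\<^sup>2 - (-y)\<^sup>2) / 2)"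
        using k(1) by (intro mult_left_mono) auto
      then show ?thesis using pos[of "- y" "- z"] 2 that unfolding odd by linarith
    next
      case 3
      \<comment> \<open>Points on opposite sides of 0 are compared through 0. The factor 1/4 is
        dictated by \<open>y\<^sup>2 + z\<^sup>2 \<ge> (y - z)\<^sup>2 / 2\<close>.\<close>
      have "0 \<le> (y + z)\<^sup>2" by simp
      then have "(y - z)\<^sup>2 / 4 \<le> (y\<^sup>2 - 0\<^sup>2) / 2 + ((-z)\<^sup>2 - 0\<^sup>2) / 2"
        by (simp add: power2_eq_square algebra_simps)
      then have "k * ((y - z) + (y - z)\<^sup>2 / 4)
          \<le> k * (((y - 0) + (y\<^sup>2 - 0\<^sup>2) / 2) + ((- z - 0) + ((-z)\<^sup>2 - 0\<^sup>2) / 2))"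
        using k(1) by (intro mult_left_mono) auto
      also have "\<dots> = k * ((y - 0) + (y\<^sup>2 - 0\<^sup>2) / 2) + k * ((- z - 0) + ((-z)\<^sup>2 - 0\<^sup>2) / 2)"
        by (rule distrib_left)
      also have "\<dots> \<le> (L y - L 0) + (L (- z) - L 0)"
        using 3 by (intro add_mono pos) auto
      also have "L 0 = 0" using odd[of 0] by simp
      finally show ?thesis unfolding odd by simp
    qed
  qed
  then show ?thesis using that k(1) by blast
qed

section \<open>Failure of the logarithmic Sobolev inequality\<close>

text \<open>The polynomial parameter makes the family closed under differentiation, so smoothness of
  all orders follows from one derivative.\<close>

definition inv_poly_exp :: "real \<Rightarrow> real \<Rightarrow> real poly \<Rightarrow> real \<Rightarrow> real" where
  "inv_poly_exp a h p x = (if x > a then poly p (inverse (x - a)) * exp (- h * inverse (x - a)) else 0)"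

lemma tendsto_poly_mult_exp_neg:
  fixes p :: "real poly" and h :: real
  assumes "h > 0"
  shows "((\<lambda>t. poly p t * exp (- h * t)) \<longlongrightarrow> 0) at_top"
proof -
  have "((\<lambda>t. coeff p i * (t ^ i * exp (- h * t))) \<longlongrightarrow> 0) at_top" for i
  proof -
    have "((\<lambda>t. (h * t) ^ i / exp (h * t)) \<longlongrightarrow> 0) at_top"
      by (rule filterlim_compose[OF tendsto_power_div_exp_0])
        (intro filterlim_tendsto_pos_mult_at_top[OF tendsto_const assms] filterlim_ident)
    then have "((\<lambda>t. (coeff p i / h ^ i) * ((h * t) ^ i / exp (h * t))) \<longlongrightarrow> 0) at_top"
      by (rule tendsto_mult_right_zero)
    then show ?thesis
      using assms by (simp add: field_simps exp_minus)
  qed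
  then have "((\<lambda>t. \<Sum>i\<le>degree p. coeff p i * (t ^ i * exp (- h * t))) \<longlongrightarrow> 0) at_top"
    by (intro tendsto_null_sum) blast
  then show ?thesis
    by (simp add: poly_altdef sum_distrib_right mult.assoc)
qed

text \<open>With \<open>u = inverse (x - a)\<close> one has \<open>u' = - u\<^sup>2\<close>, so
  differentiating \<open>p(u) * exp (- h * u)\<close> replaces \<open>p\<close> by
  \<open>u\<^sup>2 * (h * p - p')\<close>. At \<open>a\<close> itself the difference quotient tends
  to 0 from both sides.\<close>

lemma inv_poly_exp_has_derivative:
  assumes h: "h > 0"
  shows "(inv_poly_exp a h p has_real_derivative
           inv_poly_exp a h ([:0, 0, 1:] * (smult h p - pderiv p)) x) (at x)"
proof (rule linorder_cases[of x a])
  assume x: "x < a"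
  show ?thesis
    by (rule has_field_derivative_transform_within_open[of "\<lambda>_. 0" _ _ "{..<a}"])
      (use x in \<open>auto simp: inv_poly_exp_def\<close>)
next
  assume x: "x > a"
  have u: "((\<lambda>x. inverse (x - a)) has_real_derivative - (inverse (x - a))\<^sup>2) (at x)"
    using x by (auto intro!: derivative_eq_intros simp: power2_eq_square)
  have "((\<lambda>x. poly p (inverse (x - a)) * exp (- h * inverse (x - a))) has_real_derivative
      poly p (inverse (x - a)) * (exp (- h * inverse (x - a)) * (- h * - (inverse (x - a))\<^sup>2))
      + (poly (pderiv p) (inverse (x - a)) * - (inverse (x - a))\<^sup>2) * exp (- h * inverse (x - a))) (at x)"
    by (intro DERIV_mult' DERIV_chain2[OF poly_DERIV u] DERIV_chain2[OF DERIV_exp] DERIV_cmult u)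
  then have "((\<lambda>x. poly p (inverse (x - a)) * exp (- h * inverse (x - a))) has_real_derivative
      inv_poly_exp a h ([:0, 0, 1:] * (smult h p - pderiv p)) x) (at x)"
    using x by (simp add: inv_poly_exp_def power2_eq_square algebra_simps)
  then show ?thesis
    by (rule has_field_derivative_transform_within_open[of _ _ _ "{a<..}"])
      (use x in \<open>auto simp: inv_poly_exp_def\<close>)
next
  assume x: "x = a"
  have "((\<lambda>y. inv_poly_exp a h p y / (y - a)) \<longlongrightarrow> 0) (at_right a)"
  proof -
    have *: "filterlim (\<lambda>y. inverse (y - a)) at_top (at_right a)"
      by (intro filterlim_compose[OF filterlim_inverse_at_top_right])
        (auto simp: filterlim_at eventually_at_filter intro!: tendsto_eq_intros)
    \<comment> \<open>Dividing by \<open>y - a\<close> multiplies the polynomial by its variable, so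
      the difference quotient has the same form again.\<close>
    have "((\<lambda>y. poly (pCons 0 p) (inverse (y - a)) * exp (- h * inverse (y - a))) \<longlongrightarrow> 0) (at_right a)"
      by (rule filterlim_compose[OF tendsto_poly_mult_exp_neg[OF h] *])
    then show ?thesis
      by (rule Lim_transform_eventually)
        (auto simp: inv_poly_exp_def eventually_at_filter field_simps)
  qed
  moreover have "((\<lambda>y. inv_poly_exp a h p y / (y - a)) \<longlongrightarrow> 0) (at_left a)"
    by (rule Lim_transform_eventually[OF tendsto_const])
      (auto simp: inv_poly_exp_def eventually_at_filter)
  ultimately have "((\<lambda>y. inv_poly_exp a h p y / (y - a)) \<longlongrightarrow> 0) (at a)"
    by (simp add: filterlim_at_split)
  then show ?thesis
    using x by (simp add: has_field_derivative_iff inv_poly_exp_def)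
qed

lemma smooth_inv_poly_exp:
  assumes "h > 0"
  shows "smooth (inv_poly_exp a h p)"
proof -
  have "\<exists>q. (deriv ^^ k) (inv_poly_exp a h p) = inv_poly_exp a h q" for k
  proof (induction k)
    case (Suc k)
    then obtain q where "(deriv ^^ k) (inv_poly_exp a h p) = inv_poly_exp a h q" by blast
    then have "(deriv ^^ Suc k) (inv_poly_exp a h p)
        = inv_poly_exp a h ([:0, 0, 1:] * (smult h q - pderiv q))"
      using DERIV_imp_deriv[OF inv_poly_exp_has_derivative[OF assms]] by (simp del: mult_pCons_left add: ext)
    then show ?case by blast
  qed auto
  then show ?thesis
    unfolding smooth_def using inv_poly_exp_has_derivative[OF assms]
    by (metis real_differentiable_def)
qed

definition bump :: "real \<Rightarrow> real \<Rightarrow> real \<Rightarrow> real" where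
  "bump a h = inv_poly_exp a h 1"

lemma bump_simps: "x \<le> a \<Longrightarrow> bump a h x = 0" "a < x \<Longrightarrow> bump a h x = exp (- h / (x - a))"
  by (simp_all add: bump_def inv_poly_exp_def inverse_eq_divide)

lemma bump_measurable [measurable]: "bump a h \<in> borel_measurable borel"
proof -
  have "bump a h = (\<lambda>x. if a < x then exp (- h * inverse (x - a)) else 0)"
    by (simp add: fun_eq_iff bump_def inv_poly_exp_def)
  then show ?thesis by simp
qed

lemma bump_bounds: "0 < h \<Longrightarrow> 0 \<le> bump a h x" "0 < h \<Longrightarrow> bump a h x \<le> 1"
  by (cases "x \<le> a"; simp add: bump_simps)+

lemma bump_ge: "0 < h \<Longrightarrow> a + h \<le> x \<Longrightarrow> exp (- 1) \<le> bump a h x"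
  by (auto simp: bump_simps field_simps)

text \<open>With \<open>s = h / (x - a)\<close> the derivative is
  \<open>s\<^sup>2 * exp (- s) / h\<close>, and \<open>s\<^sup>2 \<le> 2 * exp s\<close> bounds it
  by \<open>2 / h\<close>.\<close>

lemma deriv_bump_sq_le:
  assumes h: "0 < h"
  shows "(deriv (bump a h) x)\<^sup>2 \<le> 4 / h\<^sup>2 * indicator {a<..} x"
proof (cases "a < x")
  case True
  define s where "s = h * inverse (x - a)"
  have s: "0 \<le> s" using True h by (simp add: s_def)
  have u: "inverse (x - a) = s / h" using h by (simp add: s_def)
  have "deriv (bump a h) x = inv_poly_exp a h ([:0, 0, 1:] * (smult h 1 - pderiv 1)) x"
    unfolding bump_def by (rule DERIV_imp_deriv[OF inv_poly_exp_has_derivative[OF h]])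
  also have "\<dots> = s\<^sup>2 * exp (- s) / h"
    using True h by (simp add: inv_poly_exp_def u power2_eq_square)
  finally have d: "deriv (bump a h) x = s\<^sup>2 * exp (- s) / h" .
  have "s\<^sup>2 \<le> 2 * exp s" using exp_lower_Taylor_quadratic[OF s] s by simp
  then have "s\<^sup>2 * exp (- s) \<le> 2 * exp s * exp (- s)" by (intro mult_right_mono) auto
  then have "s\<^sup>2 * exp (- s) \<le> 2" by (simp only: mult.assoc exp_minus_inverse mult_1_right)
  then have "(s\<^sup>2 * exp (- s))\<^sup>2 \<le> 2\<^sup>2" by (intro power_mono) auto
  then show ?thesis using True h by (simp add: d power_divide divide_right_mono)
next
  case False
  then have "deriv (bump a h) x = 0"
    unfolding bump_def by (simp add: DERIV_imp_deriv[OF inv_poly_exp_has_derivative[OF h]] inv_poly_exp_def)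
  then show ?thesis by simp
qed

section \<open>Entropy on small supports and estimates near the flat points\<close>

text \<open>Jensen's inequality on \<open>A\<close>, in the form of Young's inequality with
  \<open>c\<close> chosen so that \<open>m\<close> and \<open>exp c * measure M A\<close> cancel. A
  small support forces a large entropy.\<close>

lemma Ent_supported_ge:
  fixes M :: "real measure" and g :: "real \<Rightarrow> real"
  assumes "prob_space M" and A [measurable]: "A \<in> sets M"
    and int: "integrable M g" "integrable M (\<lambda>x. g x * ln (g x))"
    and g: "\<And>x. 0 \<le> g x" "\<And>x. x \<notin> A \<Longrightarrow> g x = 0"
    and pos: "0 < measure M A" "0 < (\<integral>x. g x \<partial>M)"
  shows "(\<integral>x. g x \<partial>M) * - ln (measure M A) \<le> Ent M g"
proof -
  interpret prob_space M by fact
  define m where "m = (\<integral>x. g x \<partial>M)"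
  define c where "c = ln (m / measure M A)"
  have c: "exp c = m / measure M A" using pos by (simp add: c_def m_def)
  have ind: "integrable M (indicator A :: real \<Rightarrow> real)"
    by (intro integrable_const_bound[of _ 1]) auto
  have "m * c = (\<integral>x. g x * c + g x - exp c * indicator A x \<partial>M)"
    using int(1) ind pos(1) by (simp add: c m_def)
  also have "\<dots> \<le> (\<integral>x. g x * ln (g x) \<partial>M)"
  proof (rule integral_mono)
    fix x
    show "g x * c + g x - exp c * indicator A x \<le> g x * ln (g x)"
      using entropy_ge_affine[OF g(1), of 1 x c] g(2)[of x] by (cases "x \<in> A") auto
  qed (use int ind in auto)
  finally show ?thesis
    using pos by (simp add: Ent_def c_def m_def ln_div algebra_simps)
qed

text \<open>Modulo \<open>2 * pi\<close> the angle \<open>2 * a\<close> is \<open>- pi / 2\<close>,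
  so \<open>1 + sin (2 * (a + t))\<close> equals
  \<open>1 - cos (2 * t) = 2 * (sin t)\<^sup>2\<close>, of second order in \<open>t\<close>.\<close>

lemma V_deriv_le_at_flat_point:
  fixes a t \<beta> :: real and n :: nat
  assumes \<beta>: "2 < \<beta>" and a: "a = real n * pi - pi / 4" "0 \<le> a" and t: "0 \<le> t"
  shows "V_deriv \<beta> (a + t) \<le> 6 * (a + t)\<^sup>2 * t\<^sup>2 + 6 * (a + t) + \<beta> * (a + t) powr (\<beta> - 1)"
proof -
  have "2 * (a + t) = (2 * t - pi / 2) + 2 * real n * pi" by (simp add: a algebra_simps)
  then have "sin (2 * (a + t)) = sin (2 * t - pi / 2)"
    by (simp only: sin_add[of _ "2 * real n * pi"] sin_2npi cos_2npi mult_zero_right mult_1_right add_0_right)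
  also have "\<dots> = - cos (2 * t)" by (simp add: sin_diff)
  also have "\<dots> = 2 * (sin t)\<^sup>2 - 1" by (simp add: cos_double_sin)
  finally have "1 + sin (2 * (a + t)) = 2 * (sin t)\<^sup>2" by simp
  moreover have "(sin t)\<^sup>2 \<le> t\<^sup>2"
    using abs_sin_x_le_abs_x[of t] by (simp add: abs_le_square_iff)
  ultimately have "3 * (a + t)\<^sup>2 * (1 + sin (2 * (a + t))) \<le> 3 * (a + t)\<^sup>2 * (2 * t\<^sup>2)"
    by (intro mult_left_mono) auto
  moreover have "6 * (a + t) * (sin (a + t))\<^sup>2 \<le> 6 * (a + t) * 1"
    using a t by (intro mult_left_mono) (auto simp: abs_square_le_1)
  moreover have "3 * (a + t)\<^sup>2 * (2 * t\<^sup>2) = 6 * (a + t)\<^sup>2 * t\<^sup>2" by simp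
  ultimately show ?thesis unfolding V_deriv_def by linarith
qed

text \<open>By the mean value theorem the increment is bounded by multiples of
  \<open>a\<^sup>2 * h ^ 3\<close>, \<open>a * h\<close> and
  \<open>h * a powr (\<beta> - 1)\<close>. The last equals 1 by the choice of \<open>h\<close>; the
  others are the powers \<open>5 - 3 * \<beta>\<close> and \<open>2 - \<beta>\<close> of
  \<open>a\<close>, both negative. The length \<open>2 * h\<close> leaves room for an interval of
  length \<open>h\<close> beyond the rise of the cutoff.\<close>

lemma V_increment_le:
  fixes a \<beta> :: real and n :: nat
  assumes \<beta>: "2 < \<beta>" and a: "a = real n * pi - pi / 4" "1 \<le> a"
  defines "h \<equiv> a powr (1 - \<beta>)"
  shows "V \<beta> (a + 2 * h) - V \<beta> a \<le> 468 + 2 * \<beta> * 3 powr (\<beta> - 1)"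
proof -
  have h: "0 < h" "h \<le> 1" using a(2) \<beta> powr_mono[of "1 - \<beta>" 0 a] by (auto simp: h_def)
  have "\<exists>z. a < z \<and> z < a + 2 * h \<and> V \<beta> (a + 2 * h) - V \<beta> a = (a + 2 * h - a) * V_deriv \<beta> z"
    using h a by (intro MVT2) (auto intro: V_has_derivative)
  then obtain z where z: "a < z" "z < a + 2 * h" "V \<beta> (a + 2 * h) - V \<beta> a = 2 * h * V_deriv \<beta> z" by auto
  have z3: "z \<le> 3 * a" using z h a by linarith
  have "V_deriv \<beta> z \<le> 6 * z\<^sup>2 * (z - a)\<^sup>2 + 6 * z + \<beta> * z powr (\<beta> - 1)"
    using V_deriv_le_at_flat_point[OF \<beta> a(1), of "z - a"] a(2) z by simp
  also have "\<dots> \<le> 6 * (3 * a)\<^sup>2 * (2 * h)\<^sup>2 + 6 * (3 * a) + \<beta> * (3 * a) powr (\<beta> - 1)"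
    using z z3 a \<beta> by (intro add_mono mult_mono power_mono powr_mono2) auto
  finally have "2 * h * V_deriv \<beta> z \<le> 2 * h * (6 * (3 * a)\<^sup>2 * (2 * h)\<^sup>2 + 6 * (3 * a) + \<beta> * (3 * a) powr (\<beta> - 1))"
    using h by (intro mult_left_mono) auto
  \<comment> \<open>Here 432 is \<open>2 * 6 * 3\<^sup>2 * 2\<^sup>2\<close> and 36 is
    \<open>2 * 6 * 3\<close>; together they give 468.\<close>
  also have "\<dots> = 432 * (a\<^sup>2 * h ^ 3) + 36 * (a * h) + 2 * \<beta> * 3 powr (\<beta> - 1) * (h * a powr (\<beta> - 1))"
    using a by (simp add: powr_mult power2_eq_square power3_eq_cube algebra_simps)
  also have "h * a powr (\<beta> - 1) = 1" using a(2) by (simp add: h_def flip: powr_add)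
  also have "a * h = a powr (2 - \<beta>)"
    using a(2) powr_add[of a 1 "1 - \<beta>"] by (simp add: h_def)
  also have "a\<^sup>2 * h ^ 3 = a powr (5 - 3 * \<beta>)"
  proof -
    have "h ^ 3 = a powr (3 * (1 - \<beta>))" using a(2) by (simp add: h_def powr_power algebra_simps)
    moreover have "a\<^sup>2 = a powr 2" using a(2) by simp
    ultimately show ?thesis by (simp add: algebra_simps flip: powr_add)
  qed
  also have "432 * a powr (5 - 3 * \<beta>) + 36 * a powr (2 - \<beta>) + 2 * \<beta> * 3 powr (\<beta> - 1) * 1
      \<le> 432 * 1 + 36 * 1 + 2 * \<beta> * 3 powr (\<beta> - 1) * 1"
    using a(2) \<beta> powr_mono[of "5 - 3 * \<beta>" 0 a] powr_mono[of "2 - \<beta>" 0 a] by (intro add_mono mult_left_mono) auto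
  finally show ?thesis using z(3) by simp
qed

lemma measure_mu_Ioc_bounds:
  assumes "0 < \<beta>" "0 \<le> a" "a \<le> b"
  shows "measure (mu \<beta>) {a<..b} \<le> (b - a) * mu_density \<beta> a"
    and "(b - a) * mu_density \<beta> b \<le> measure (mu \<beta>) {a<..b}"
proof -
  have nonneg: "0 \<le> mu_density \<beta> x" for x using mu_density_pos[of \<beta> x] by simp
  have prob: "prob_space (density lborel (\<lambda>x. ennreal (mu_density \<beta> x)))"
    using prob_space_mu[of \<beta>] by (simp add: mu_eq)
  have eq: "measure (mu \<beta>) {a<..b} = (LINT x:{a<..b}|lborel. mu_density \<beta> x)"
    using measure_density_eq_set_integral[OF _ nonneg prob] by (simp add: mu_eq)
  have int: "set_integrable lborel {a<..b} (mu_density \<beta>)"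
    by (rule set_integrable_prob_density[OF _ nonneg prob]) auto
  have cint: "set_integrable lborel {a<..b} (\<lambda>_. c)" for c :: real
    unfolding set_integrable_def using assms by (intro integrable_scaleR_left integrable_real_indicator) auto
  have c: "(LINT x:{a<..b}|lborel. c) = (b - a) * c" for c :: real
    using assms by (simp add: set_lebesgue_integral_def)
  show "measure (mu \<beta>) {a<..b} \<le> (b - a) * mu_density \<beta> a"
    unfolding eq c[symmetric] using assms
    by (intro set_integral_mono int cint) (auto intro: mu_density_antimono)
  show "(b - a) * mu_density \<beta> b \<le> measure (mu \<beta>) {a<..b}"
    unfolding eq c[symmetric] using assms
    by (intro set_integral_mono int cint) (auto intro: mu_density_antimono)
qed

lemma measure_mu_tail_le:
  assumes a: "1 \<le> a"
  shows "measure (mu \<beta>) {a<..} \<le> exp (- (a ^ 3)) / Z \<beta>"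
proof -
  interpret prob_space "mu \<beta>" by (rule prob_space_mu)
  have "ennreal (measure (mu \<beta>) {a<..}) = (\<integral>\<^sup>+x. ennreal (mu_density \<beta> x) * indicator {a<..} x \<partial>lborel)"
    by (simp add: emeasure_mu flip: emeasure_eq_measure)
  also have "\<dots> \<le> (\<integral>\<^sup>+x. ennreal (1 / Z \<beta>) * (ennreal (exp (- (x ^ 3))) * indicator {a..} x) \<partial>lborel)"
  proof (intro nn_integral_mono)
    fix x
    have "mu_density \<beta> x \<le> 1 / Z \<beta> * exp (- (x ^ 3))" if "a < x"
      using V_ge_cube[of x \<beta>] Z_pos[of \<beta>] that a by (simp add: mu_density_def divide_right_mono)
    then show "ennreal (mu_density \<beta> x) * indicator {a<..} x
        \<le> ennreal (1 / Z \<beta>) * (ennreal (exp (- (x ^ 3))) * indicator {a..} x)"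
      using Z_pos[of \<beta>] by (auto simp: indicator_def ennreal_leI simp flip: ennreal_mult)
  qed
  also have "\<dots> \<le> ennreal (1 / Z \<beta>) * ennreal (exp (- (a ^ 3)))"
    using nn_integral_exp_neg_cube_le[OF a] by (subst nn_integral_cmult) (auto intro: mult_left_mono)
  also have "\<dots> = ennreal (exp (- (a ^ 3)) / Z \<beta>)"
    using Z_pos[of \<beta>] by (simp flip: ennreal_mult)
  finally show ?thesis using Z_pos[of \<beta>] by (simp add: ennreal_le_iff)
qed

lemma abs_mult_ln_le_one:
  fixes t :: real
  assumes "0 \<le> t" "t \<le> 1"
  shows "\<bar>t * ln t\<bar> \<le> 1"
proof (cases "t = 0")
  case False
  then have "ln (1 / t) \<le> 1 / t - 1" using assms by (intro ln_le_minus_one) auto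
  then have "t * - ln t \<le> t * (1 / t - 1)" using False assms by (intro mult_left_mono) (auto simp: ln_div)
  also have "\<dots> \<le> 1" using False assms by (simp add: algebra_simps)
  finally have "- (t * ln t) \<le> 1" by simp
  moreover have "t * ln t \<le> 0" using False assms by (simp add: mult_nonneg_nonpos)
  ultimately show ?thesis by linarith
qed auto

text \<open>For the test function \<open>bump a h\<close> the inequality yields
  \<open>m * - ln m0 \<le> 4 * C' * m0 / h\<^sup>2\<close>. The comparison
  \<open>m0 \<le> (1 + K) * exp 2 * m\<close> removes the masses, and the cubic lower bound on
  \<open>V\<close> gives \<open>- ln m0 \<ge> a ^ 3 + ln (Z \<beta>)\<close>.\<close>

lemma LS_imp_bound:
  fixes a \<beta> :: real and n :: nat
  assumes LS: "satisfies_LS (mu \<beta>) C'" and C': "0 < C'"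
    and \<beta>: "2 < \<beta>" and a: "a = real n * pi - pi / 4" "1 \<le> a"
  defines "K \<equiv> exp (468 + 2 * \<beta> * 3 powr (\<beta> - 1))"
  shows "a powr (2 - 2 * \<beta>) * (a ^ 3 + ln (Z \<beta>)) \<le> 4 * C' * exp 2 * (1 + K)"
proof -
  interpret real_distribution "mu \<beta>"
    using real_distribution_density prob_space_mu[of \<beta>] by (simp add: mu_eq)
  define h where "h = a powr (1 - \<beta>)"
  have h: "0 < h" using a(2) by (simp add: h_def)
  define g where "g x = (bump a h x)\<^sup>2" for x
  have [measurable]: "g \<in> borel_measurable borel" unfolding g_def by measurable
  have g: "0 \<le> g x" "g x \<le> 1" for x
    using bump_bounds[OF h, of a x] by (auto simp: g_def abs_square_le_1)
  define m0 where "m0 = measure (mu \<beta>) {a<..}"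
  define \<tau> where "\<tau> = measure (mu \<beta>) {a + h<..}"
  define m where "m = (\<integral>x. g x \<partial>mu \<beta>)"
  have int_g: "integrable (mu \<beta>) g"
    using g by (intro integrable_const_bound[of _ 1]) auto
  have int_gln: "integrable (mu \<beta>) (\<lambda>x. g x * ln (g x))"
    using g abs_mult_ln_le_one by (intro integrable_const_bound[of _ 1]) auto
  \<comment> \<open>The constant is the square of the lower bound \<open>exp (- 1)\<close> of the
    cutoff beyond \<open>a + h\<close>.\<close>
  have m_ge: "exp (- 2) * \<tau> \<le> m"
  proof -
    have ind: "integrable (mu \<beta>) (indicator {a + h<..} :: real \<Rightarrow> real)"
      by (intro integrable_const_bound[of _ 1]) auto
    have "exp (- 2) * \<tau> = (\<integral>x. exp (- 2) * indicator {a + h<..} x \<partial>mu \<beta>)"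
      by (simp add: \<tau>_def)
    also have "\<dots> \<le> m"
      unfolding m_def
    proof (rule integral_mono)
      fix x
      have "exp (- 2) \<le> g x" if "a + h < x"
        using power_mono[OF bump_ge[OF h, of a x], of 2] that
        by (simp add: g_def flip: exp_double)
      then show "exp (- 2) * indicator {a + h<..} x \<le> g x" using g(1)[of x] by (auto simp: indicator_def)
    qed (use int_g ind in auto)
    finally show ?thesis .
  qed
  \<comment> \<open>The mass of \<open>{a<..a + h}\<close>, where the cutoff may be small, is
    compared with that of \<open>{a + h<..a + 2 * h}\<close>: the density decreases, but by no more
    than the factor \<open>K\<close> over this range.\<close>
  have \<tau>_ge: "m0 \<le> (1 + K) * \<tau>" and \<tau>_pos: "0 < \<tau>"
  proof -
    have "exp (- V \<beta> a) \<le> K * exp (- V \<beta> (a + 2 * h))"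
      using V_increment_le[OF \<beta> a] by (simp add: K_def h_def flip: exp_add)
    then have dens: "mu_density \<beta> a \<le> K * mu_density \<beta> (a + 2 * h)"
      using Z_pos[of \<beta>] by (simp add: mu_density_def divide_right_mono)
    have "h * mu_density \<beta> (a + 2 * h) \<le> measure (mu \<beta>) {a + h<..a + 2 * h}"
      using measure_mu_Ioc_bounds(2)[of \<beta> "a + h" "a + 2 * h"] \<beta> a(2) h by simp
    also have "\<dots> \<le> \<tau>" unfolding \<tau>_def by (intro finite_measure_mono) auto
    finally have \<tau>1: "h * mu_density \<beta> (a + 2 * h) \<le> \<tau>" .
    moreover have "0 < h * mu_density \<beta> (a + 2 * h)" using h mu_density_pos by simp
    ultimately show "0 < \<tau>" by linarith
    have "measure (mu \<beta>) {a<..a + h} \<le> h * mu_density \<beta> a"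
      using measure_mu_Ioc_bounds(1)[of \<beta> a "a + h"] \<beta> a(2) h by simp
    also have "\<dots> \<le> h * (K * mu_density \<beta> (a + 2 * h))" using dens h by (intro mult_left_mono) auto
    also have "\<dots> = K * (h * mu_density \<beta> (a + 2 * h))" by simp
    also have "\<dots> \<le> K * \<tau>" using \<tau>1 by (intro mult_left_mono) (auto simp: K_def)
    finally have "measure (mu \<beta>) {a<..a + h} \<le> K * \<tau>" .
    moreover have "m0 = measure (mu \<beta>) {a<..a + h} + \<tau>"
    proof -
      have eq: "{a<..} = {a<..a + h} \<union> {a + h<..}" using h by auto
      show ?thesis
        unfolding m0_def \<tau>_def by (subst eq, rule finite_measure_Union) auto
    qed
    ultimately show "m0 \<le> (1 + K) * \<tau>" by (simp add: algebra_simps)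
  qed
  have "0 < exp (- 2) * \<tau>" using \<tau>_pos by simp
  then have m_pos: "0 < m" using m_ge by linarith
  have "\<tau> \<le> m0" unfolding m0_def \<tau>_def using h by (intro finite_measure_mono) auto
  then have m0_pos: "0 < m0" using \<tau>_pos by simp
  have "m * - ln m0 \<le> Ent (mu \<beta>) g"
    unfolding m_def m0_def
  proof (rule Ent_supported_ge)
    show "g x = 0" if "x \<notin> {a<..}" for x using that by (simp add: g_def bump_simps)
  qed (use int_g int_gln g m0_pos m_pos in \<open>auto simp: m0_def m_def prob_space_axioms\<close>)
  also have "ereal (Ent (mu \<beta>) g) \<le> ereal C' * enn2ereal (\<integral>\<^sup>+ x. ennreal ((deriv (bump a h) x)\<^sup>2) \<partial>mu \<beta>)"
    using LS[unfolded satisfies_LS_def, rule_format, of "bump a h"] smooth_inv_poly_exp[OF h, of a 1] int_g int_gln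
    by (simp add: g_def[abs_def] flip: bump_def)
  also have "\<dots> \<le> ereal C' * enn2ereal (ennreal (4 / h\<^sup>2 * m0))"
  proof (intro ereal_mult_left_mono)
    have "(\<integral>\<^sup>+ x. ennreal ((deriv (bump a h) x)\<^sup>2) \<partial>mu \<beta>)
        \<le> (\<integral>\<^sup>+ x. ennreal (4 / h\<^sup>2) * indicator {a<..} x \<partial>mu \<beta>)"
    proof (intro nn_integral_mono)
      fix x
      show "ennreal ((deriv (bump a h) x)\<^sup>2) \<le> ennreal (4 / h\<^sup>2) * indicator {a<..} x"
        using deriv_bump_sq_le[OF h, of a x] by (auto simp: indicator_def ennreal_leI split: if_splits)
    qed
    also have "\<dots> = ennreal (4 / h\<^sup>2 * m0)"
      by (subst nn_integral_cmult_indicator) (auto simp: m0_def emeasure_eq_measure simp flip: ennreal_mult)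
    finally show "enn2ereal (\<integral>\<^sup>+ x. ennreal ((deriv (bump a h) x)\<^sup>2) \<partial>mu \<beta>) \<le> enn2ereal (ennreal (4 / h\<^sup>2 * m0))"
      by (simp add: less_eq_ennreal.rep_eq)
  qed (use C' in auto)
  also have "\<dots> = ereal (C' * (4 / h\<^sup>2 * m0))"
    using m0_pos by (simp add: enn2ereal_ennreal)
  finally have main: "m * - ln m0 \<le> C' * (4 / h\<^sup>2 * m0)" by simp
  have "m0 \<le> (1 + K) * (exp 2 * m)"
  proof -
    have "(1 + K) * \<tau> \<le> (1 + K) * (exp 2 * m)"
      using m_ge by (intro mult_left_mono) (auto simp: K_def exp_minus field_simps)
    then show ?thesis using \<tau>_ge by simp
  qed
  then have "C' * (4 / h\<^sup>2 * m0) \<le> C' * (4 / h\<^sup>2 * ((1 + K) * (exp 2 * m)))"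
    using C' by (intro mult_left_mono) auto
  with main have "m * - ln m0 \<le> m * (4 * C' * exp 2 * (1 + K) / h\<^sup>2)" by (simp add: mult_ac)
  then have "- ln m0 \<le> 4 * C' * exp 2 * (1 + K) / h\<^sup>2" using m_pos by (simp only: mult_le_cancel_left_pos)
  moreover have "a ^ 3 + ln (Z \<beta>) \<le> - ln m0"
  proof -
    have "ln m0 \<le> ln (exp (- (a ^ 3)) / Z \<beta>)"
      using m0_pos measure_mu_tail_le[OF a(2), of \<beta>] by (intro ln_mono) (auto simp: m0_def)
    then show ?thesis using Z_pos[of \<beta>] by (simp add: ln_div)
  qed
  ultimately have "h\<^sup>2 * (a ^ 3 + ln (Z \<beta>)) \<le> h\<^sup>2 * (4 * C' * exp 2 * (1 + K) / h\<^sup>2)"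
    by (intro mult_left_mono) auto
  then have "h\<^sup>2 * (a ^ 3 + ln (Z \<beta>)) \<le> 4 * C' * exp 2 * (1 + K)" using h by simp
  moreover have "h\<^sup>2 = a powr (2 - 2 * \<beta>)"
    using a(2) by (simp add: h_def powr_power algebra_simps)
  ultimately show ?thesis by (simp only:)
qed

text \<open>Along the flat points the left side of \<open>LS_imp_bound\<close> contains
  \<open>a powr (5 - 2 * \<beta>)\<close>, which is unbounded because
  \<open>\<beta> < 5 / 2\<close>, whereas the right side is independent of \<open>a\<close>.\<close>

lemma not_satisfies_LS:
  assumes \<beta>: "2 < \<beta>" "\<beta> < 5 / 2" and C': "0 < C'"
  shows "\<not> satisfies_LS (mu \<beta>) C'"
proof
  assume LS: "satisfies_LS (mu \<beta>) C'"
  define B where "B = 4 * C' * exp 2 * (1 + exp (468 + 2 * \<beta> * 3 powr (\<beta> - 1)))"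
  have "filterlim (\<lambda>a. ln (Z \<beta>) * a powr (2 - 2 * \<beta>) + a powr (5 - 2 * \<beta>)) at_top at_top"
  \<comment> \<open>Whatever the sign of \<open>ln (Z \<beta>)\<close>, its coefficient tends to
    0.\<close>
  proof (rule filterlim_tendsto_add_at_top)
    have "((\<lambda>a. a powr (2 - 2 * \<beta>)) \<longlongrightarrow> 0) at_top"
      using \<beta> by (intro tendsto_neg_powr filterlim_ident) auto
    then show "((\<lambda>a. ln (Z \<beta>) * a powr (2 - 2 * \<beta>)) \<longlongrightarrow> 0) at_top"
      by (rule tendsto_mult_right_zero)
    show "filterlim (\<lambda>a. a powr (5 - 2 * \<beta>)) at_top at_top"
      using \<beta> by (intro real_powr_at_top) auto
  qed
  moreover have "filterlim (\<lambda>n. real n * pi - pi / 4) at_top sequentially"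
    by real_asymp
  ultimately have "filterlim (\<lambda>n. ln (Z \<beta>) * (real n * pi - pi / 4) powr (2 - 2 * \<beta>)
      + (real n * pi - pi / 4) powr (5 - 2 * \<beta>)) at_top sequentially"
    by (rule filterlim_compose)
  then have "\<forall>\<^sub>F n in sequentially. B < ln (Z \<beta>) * (real n * pi - pi / 4) powr (2 - 2 * \<beta>)
      + (real n * pi - pi / 4) powr (5 - 2 * \<beta>)"
    by (simp add: filterlim_at_top_dense)
  moreover have "\<forall>\<^sub>F n in sequentially. 1 \<le> real n * pi - pi / 4" by real_asymp
  ultimately have "\<forall>\<^sub>F n::nat in sequentially. False"
  proof eventually_elim
    case (elim n)
    define a where "a = real n * pi - pi / 4"
    have a: "1 \<le> a" using elim by (simp add: a_def)
    have "a powr (2 - 2 * \<beta>) * a ^ 3 = a powr (5 - 2 * \<beta>)"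
    proof -
      have "a ^ 3 = a powr 3" using a by simp
      then show ?thesis by (simp flip: powr_add)
    qed
    then have "ln (Z \<beta>) * a powr (2 - 2 * \<beta>) + a powr (5 - 2 * \<beta>) \<le> B"
      using LS_imp_bound[OF LS C' \<beta>(1) a_def a] by (simp add: B_def algebra_simps)
    then show ?case using elim by (simp add: a_def)
  qed
  then show False by simp
qed

theorem mainTheorem13:
  fixes \<beta> :: real
  assumes "2 < \<beta>" and "\<beta> < 5/2"
  shows "(\<exists>C>0. satisfies_T2 (mu \<beta>) C) \<and> (\<forall>C'>0. \<not> satisfies_LS (mu \<beta>) C')"
proof
  show "\<exists>C>0. satisfies_T2 (mu \<beta>) C"
  proof -
    let ?F = "cdf (mu \<beta>)"
    obtain k where k: "0 < k" "\<And>y z. z \<le> y \<Longrightarrow> k * ((y - z) + (y - z)\<^sup>2 / 4)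
        \<le> (ln (?F y) - ln (1 - ?F y)) - (ln (?F z) - ln (1 - ?F z))"
      using logit_mu_growth[OF assms(1)] by metis
    define C where "C = (2 + 2 * k) / (k / 2)\<^sup>2"
    have C: "0 < C" using k(1) by (simp add: C_def)
    have growth: "(y - z)\<^sup>2 \<le> C * (trunc_cost (ln (?F z) - ln (?F y))
        + trunc_cost (ln (1 - ?F z) - ln (1 - ?F y)))" for y z
    proof -
      \<comment> \<open>The triangle inequality splits the logit increment into its lower-tail and
        upper-tail parts, the two arguments of the costs.\<close>
      have "k * (\<bar>y - z\<bar> + \<bar>y - z\<bar>\<^sup>2 / 4)
          \<le> \<bar>ln (?F z) - ln (?F y)\<bar> + \<bar>ln (1 - ?F z) - ln (1 - ?F y)\<bar>"
      proof (cases "z \<le> y")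
        case True
        then show ?thesis using k(2)[of z y] by simp
      next
        case False
        then show ?thesis using k(2)[of y z] by (simp add: power2_commute abs_minus_commute)
      qed
      then have "\<bar>y - z\<bar>\<^sup>2 \<le> C * (trunc_cost (ln (?F z) - ln (?F y))
        + trunc_cost (ln (1 - ?F z) - ln (1 - ?F y)))"
        unfolding C_def using k(1) by (intro sq_le_trunc_costs) auto
      then show ?thesis by simp
    qed
    have "satisfies_T2 (mu \<beta>) (36 * C)"
      using satisfies_T2I[of "mu_density \<beta>" C] mu_density_pos prob_space_mu[of \<beta>] C growth
      by (simp add: mu_eq)
    then show ?thesis using C by (intro exI[of _ "36 * C"]) auto
  qed
  show "\<forall>C'>0. \<not> satisfies_LS (mu \<beta>) C'"
    using not_satisfies_LS assms by auto
qed

end
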